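(* Let $\alpha>0$ and $E_{\rm target}>0$. Let $\ket{\Psi}_{AB}$ be a bipartite pure state and let an arbitrary SLOCC protocol transform it into $\{p_m,\ket{\Psi_m}_{AB}\}$. Then the accumulated success probability $P(E_\alpha\ge E_{\rm target})=\sum_{m:\,E_\alpha(\Psi_m)\ge E_{\rm target}}p_m$ satisfies $$P(E_\alpha\ge E_{\rm target})\le\frac{e^{\left(\frac{1-\alpha}{\alpha}\right)E_\alpha(\Psi)}-1}{e^{\left(\frac{1-\alpha}{\alpha}\right)E_{\rm target}}-1},$$ where for $\alpha=1$ the right-hand side is understood as its limit $E_S(\Psi)/E_{\rm target}$.
   Context: All Hilbert spaces are finite-dimensional; $\log$ is the natural logarithm. For a unit vector $\ket{\Psi}_{AB}\in\mathcal H_A\otimes\mathcal H_B$ put $\rho_B=\mathrm{Tr}_A\ket{\Psi}\bra{\Psi}$. For $\alpha>0$, $\alpha\ne1$, the Rényi entanglement entropy (REE) is $E_\alpha(\Psi)=\frac{1}{1-\alpha}\log\mathrm{Tr}[\rho_B^\alpha]$; for $\alpha=1$, $E_1=E_S$ with $E_S(\Psi)=-\mathrm{Tr}[\rho_B\log\rho_B]$. SLOCC protocol on pure states: a finite number of rounds; in each round one of the two parties (chosen depending on previous outcomes) applies a local measurement, i.e. a finite family of Kraus operators $\{K_j\}$ on its own system (possibly with a different finite-dimensional output space) with $\sum_jK_j^\dagger K_j=\mathbb 1$, which may depend on all previously obtained (classically communicated) outcomes. A sequence $m$ of outcomes corresponds to a product operator $A_m\otimes B_m$; it occurs with probability $p_m=\|(A_m\otimes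 B_m)\ket{\Psi}\|^2$, and (if $p_m>0$) the outcome state is $\ket{\Psi_m}=(A_m\otimes B_m)\ket{\Psi}/\sqrt{p_m}$. Thus $\sum_mp_m=1$, and one writes $\ket{\Psi}\to\{p_m,\ket{\Psi_m}\}$ (outcomes with $p_m=0$ are discarded). *)

theory Defs
  imports Complex_Main "Jordan_Normal_Form.Schur_Decomposition"
begin

text \<open>A finite-dimensional Hilbert space is represented by \<open>\<complex>\<^sup>d\<close> with its standard
  orthonormal basis, and \<open>\<complex>\<^sup>a \<otimes> \<complex>\<^sup>b\<close> by \<open>\<complex>\<^bsup>a b\<^esup>\<close>, where \<open>e\<^sub>i \<otimes> e\<^sub>j\<close> is the basis vector
  with index \<open>i * b + j\<close>.\<close>

definition ket_norm :: "complex vec \<Rightarrow> real" where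
  "ket_norm \<psi> = sqrt (Re (\<psi> \<bullet>c \<psi>))"

definition ketbra :: "complex vec \<Rightarrow> complex mat" where
  "ketbra \<psi> = mat (dim_vec \<psi>) (dim_vec \<psi>) (\<lambda>(i, j). \<psi> $ i * cnj (\<psi> $ j))"

definition tensor_op :: "complex mat \<Rightarrow> complex mat \<Rightarrow> complex mat" where
  "tensor_op A B = mat (dim_row A * dim_row B) (dim_col A * dim_col B)
     (\<lambda>(r, c). A $$ (r div dim_row B, c div dim_col B) * B $$ (r mod dim_row B, c mod dim_col B))"

definition mat_trace :: "complex mat \<Rightarrow> complex" where
  "mat_trace A = (\<Sum>i<dim_row A. A $$ (i, i))"

definition partial_trace_A :: "nat \<Rightarrow> nat \<Rightarrow> complex mat \<Rightarrow> complex mat" where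
  "partial_trace_A a b R = mat b b (\<lambda>(j, k). \<Sum>i<a. R $$ (i * b + j, i * b + k))"

definition unitary_diagonalization :: "complex mat \<Rightarrow> complex mat \<Rightarrow> (nat \<Rightarrow> real) \<Rightarrow> bool" where
  "unitary_diagonalization A U d \<longleftrightarrow>
     (let n = dim_row A in
      U \<in> carrier_mat n n \<and> mat_adjoint U * U = 1\<^sub>m n \<and> U * mat_adjoint U = 1\<^sub>m n \<and>
      A = U * mat_diag n (\<lambda>i. complex_of_real (d i)) * mat_adjoint U)"

text \<open>Functional calculus \<open>f(A) = U f(D) U\<^sup>\<dagger>\<close> for Hermitian \<open>A = U D U\<^sup>\<dagger>\<close>.  The result
  does not depend on the diagonalization chosen (shown below), so the description is proper.\<close>

definition mat_fun :: "(real \<Rightarrow> real) \<Rightarrow> complex mat \<Rightarrow> complex mat" where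
  "mat_fun f A = (THE F. \<exists>U d. unitary_diagonalization A U d \<and>
     F = U * mat_diag (dim_row A) (\<lambda>i. complex_of_real (f (d i))) * mat_adjoint U)"

definition reduced_B :: "nat \<Rightarrow> nat \<Rightarrow> complex vec \<Rightarrow> complex mat" where
  "reduced_B a b \<psi> = partial_trace_A a b (ketbra \<psi>)"

text \<open>Below, \<open>0 powr \<alpha> = 0\<close> for \<open>\<alpha> > 0\<close>; the value of \<open>ln 0\<close> is immaterial because
  the kernel of \<open>\<rho>\<close> is annihilated by the factor \<open>\<rho>\<close>.\<close>

definition vN_entropy_B :: "nat \<Rightarrow> nat \<Rightarrow> complex vec \<Rightarrow> real" where
  "vN_entropy_B a b \<psi> =
     (let \<rho> = reduced_B a b \<psi> in - Re (mat_trace (\<rho> * mat_fun ln \<rho>)))"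

definition REE :: "real \<Rightarrow> nat \<Rightarrow> nat \<Rightarrow> complex vec \<Rightarrow> real" where
  "REE \<alpha> a b \<psi> =
     (if \<alpha> = 1 then vN_entropy_B a b \<psi>
      else 1 / (1 - \<alpha>) * ln (Re (mat_trace (mat_fun (\<lambda>x. x powr \<alpha>) (reduced_B a b \<psi>)))))"

definition local_measurement :: "nat \<Rightarrow> complex mat list \<Rightarrow> bool" where
  "local_measurement n Ks \<longleftrightarrow>
     (\<forall>K\<in>set Ks. dim_col K = n) \<and>
     foldr (+) (map (\<lambda>K. mat_adjoint K * K) Ks) (0\<^sub>m n n) = 1\<^sub>m n"

text \<open>A protocol is a finite decision tree: each inner node names the acting party and lists its
  Kraus operators, each paired with the protocol that is continued after that outcome.  Hence a
  leaf is a sequence of outcomes.  The output dimension of a Kraus operator \<open>K\<close> is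
  \<open>dim_row K\<close>, and may depend on the outcome.\<close>

datatype protocol =
    Stop
  | Measure_A "(complex mat \<times> protocol) list"
  | Measure_B "(complex mat \<times> protocol) list"

fun slocc_protocol :: "nat \<Rightarrow> nat \<Rightarrow> protocol \<Rightarrow> bool" where
  "slocc_protocol a b Stop \<longleftrightarrow> True"
| "slocc_protocol a b (Measure_A bs) \<longleftrightarrow>
     local_measurement a (map fst bs) \<and> (\<forall>(K, Q)\<in>set bs. slocc_protocol (dim_row K) b Q)"
| "slocc_protocol a b (Measure_B bs) \<longleftrightarrow>
     local_measurement b (map fst bs) \<and> (\<forall>(K, Q)\<in>set bs. slocc_protocol a (dim_row K) Q)"

text \<open>The pairs \<open>(A\<^sub>m, B\<^sub>m)\<close>, one for each sequence \<open>m\<close> of outcomes.\<close>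

fun outcome_ops :: "nat \<Rightarrow> nat \<Rightarrow> protocol \<Rightarrow> (complex mat \<times> complex mat) list" where
  "outcome_ops a b Stop = [(1\<^sub>m a, 1\<^sub>m b)]"
| "outcome_ops a b (Measure_A bs) =
     concat (map (\<lambda>(K, Q). map (\<lambda>(A, B). (A * K, B)) (outcome_ops (dim_row K) b Q)) bs)"
| "outcome_ops a b (Measure_B bs) =
     concat (map (\<lambda>(K, Q). map (\<lambda>(A, B). (A, B * K)) (outcome_ops a (dim_row K) Q)) bs)"

definition outcome_prob :: "complex vec \<Rightarrow> complex mat \<times> complex mat \<Rightarrow> real" where
  "outcome_prob \<psi> = (\<lambda>(A, B). (ket_norm (tensor_op A B *\<^sub>v \<psi>))\<^sup>2)"

definition outcome_state :: "complex vec \<Rightarrow> complex mat \<times> complex mat \<Rightarrow> complex vec" where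
  "outcome_state \<psi> = (\<lambda>(A, B).
     complex_of_real (1 / sqrt (outcome_prob \<psi> (A, B))) \<cdot>\<^sub>v (tensor_op A B *\<^sub>v \<psi>))"

definition outcome_REE :: "real \<Rightarrow> complex vec \<Rightarrow> complex mat \<times> complex mat \<Rightarrow> real" where
  "outcome_REE \<alpha> \<psi> = (\<lambda>(A, B). REE \<alpha> (dim_row A) (dim_row B) (outcome_state \<psi> (A, B)))"

definition success_prob ::
  "real \<Rightarrow> real \<Rightarrow> nat \<Rightarrow> nat \<Rightarrow> complex vec \<Rightarrow> protocol \<Rightarrow> real" where
  "success_prob \<alpha> E a b \<psi> P =
     (let ops = outcome_ops a b P in
      \<Sum>m\<in>{m. m < length ops \<and> outcome_prob \<psi> (ops ! m) > 0 \<and> outcome_REE \<alpha> \<psi> (ops ! m) \<ge> E}.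
        outcome_prob \<psi> (ops ! m))"


lemma mat_adjoint_carrier: "A \<in> carrier_mat n m \<Longrightarrow> mat_adjoint A \<in> carrier_mat m n"
  unfolding mat_adjoint_def by (metis carrier_matD cols_length length_map mat_of_rows_carrier(1))

lemma mat_fun_eqI:
  assumes U: "unitary_diagonalization A U d"
  shows "mat_fun f A =
    U * mat_diag (dim_row A) (\<lambda>i. complex_of_real (f (d i))) * mat_adjoint U"
  unfolding mat_fun_def
proof (rule the_equality)
  define n where "n = dim_row A"
  define D where "D g = mat_diag n (\<lambda>i. complex_of_real (g i))" for g :: "nat \<Rightarrow> real"
  show "\<exists>U' d'. unitary_diagonalization A U' d' \<and>
     U * mat_diag (dim_row A) (\<lambda>i. complex_of_real (f (d i))) * mat_adjoint U =
     U' * mat_diag (dim_row A) (\<lambda>i. complex_of_real (f (d' i))) * mat_adjoint U'"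
    using U by blast
  fix F
  assume "\<exists>V e. unitary_diagonalization A V e \<and>
    F = V * mat_diag (dim_row A) (\<lambda>i. complex_of_real (f (e i))) * mat_adjoint V"
  then obtain V e where V: "unitary_diagonalization A V e"
    and F: "F = V * D (\<lambda>i. f (e i)) * mat_adjoint V"
    unfolding D_def n_def by blast
  let ?U' = "mat_adjoint U" and ?V' = "mat_adjoint V"
  have u: "U \<in> carrier_mat n n" "?U' \<in> carrier_mat n n" "?U' * U = 1\<^sub>m n" "U * ?U' = 1\<^sub>m n"
    and uA: "A = U * D d * ?U'"
    using U by (auto simp: unitary_diagonalization_def Let_def n_def D_def intro: mat_adjoint_carrier)
  have v: "V \<in> carrier_mat n n" "?V' \<in> carrier_mat n n" "?V' * V = 1\<^sub>m n" "V * ?V' = 1\<^sub>m n"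
    and vA: "A = V * D e * ?V'"
    using V by (auto simp: unitary_diagonalization_def Let_def n_def D_def intro: mat_adjoint_carrier)
  have D[simp]: "\<And>g. D g \<in> carrier_mat n n" by (simp add: D_def)
  note as = assoc_mult_mat[of _ n n _ n _ n] mult_carrier_mat[of _ n n _ n]
    right_mult_one_mat[of _ n n] left_mult_one_mat[of _ n n]
  define W where "W = ?V' * U"
  have W: "W \<in> carrier_mat n n" unfolding W_def using u(1) v(2) by (rule mult_carrier_mat[rotated])
  have "W * D d = ?V' * (U * D d * (?U' * U))"
    unfolding W_def using u v by (simp add: as)
  also have "\<dots> = ?V' * ((U * D d * ?U') * U)"
    using u(1,2) v(1,2) by (simp add: as)
  also have "\<dots> = ?V' * ((V * D e * ?V') * U)"
    using uA vA by simp
  also have "\<dots> = (?V' * V) * (D e * (?V' * U))"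
    using u(1,2) v(1,2) by (simp add: as)
  also have "\<dots> = D e * W" using v(3) W unfolding W_def by (simp add: as)
  finally have com: "W * D d = D e * W" .
  have ij: "(W * D g) $$ (i, j) = W $$ (i, j) * complex_of_real (g j)"
    "(D g * W) $$ (i, j) = complex_of_real (g i) * W $$ (i, j)" if "i < n" "j < n" for i j g
    using that W unfolding D_def by (simp_all add: mat_diag_mult_left[OF W] mat_diag_mult_right[OF W])
  have "W $$ (i, j) = 0 \<or> d j = e i" if "i < n" "j < n" for i j
    using arg_cong[OF com, of "\<lambda>M. M $$ (i, j)"] ij[OF that] by auto
  then have com': "W * D (\<lambda>i. f (d i)) = D (\<lambda>i. f (e i)) * W"
    using W carrier_matD[OF D]
    by (intro eq_matI) (fastforce simp del: index_mult_mat(1) simp: ij)+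
  have "F = V * (D (\<lambda>i. f (e i)) * ?V') * (U * ?U')"
    unfolding F using u v by (simp add: as)
  also have "\<dots> = V * (D (\<lambda>i. f (e i)) * W) * ?U'"
    unfolding W_def using u(1,2) v(1,2) by (simp add: as)
  also have "\<dots> = V * (W * D (\<lambda>i. f (d i))) * ?U'" using com' by simp
  also have "\<dots> = (V * ?V') * (U * D (\<lambda>i. f (d i)) * ?U')"
    unfolding W_def using u(1,2) v(1,2) by (simp add: as)
  also have "\<dots> = U * D (\<lambda>i. f (d i)) * ?U'"
    using u v by (simp add: as)
  finally show "F = U * mat_diag (dim_row A) (\<lambda>i. complex_of_real (f (d i))) * ?U'"
    unfolding D_def n_def .
qed

end

(*
Write N for the coefficient matrix of a not necessarily normalized bipartite vector, so that
\<rho> = N N\<^sup>\<dagger> is its reduced operator on B. The quantity |(Tr \<rho>\<^sup>\<alpha>)^(1/\<alpha>) - Tr \<rho>| for \<alpha> \<noteq> 1, and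
- Tr(\<rho> ln \<rho>) + Tr \<rho> ln(Tr \<rho>) for \<alpha> = 1, is nonnegative, homogeneous of degree one and superadditive
in \<rho>: diagonalize the sum, pass to the diagonals of the summands in that basis, which are doubly
stochastic images of their spectra, and use concavity for vectors. A measurement of A splits
N N\<^sup>\<dagger> into a sum of such operators, and a measurement of B splits N\<^sup>\<dagger> N, which has the same nonzero
spectrum. Hence the quantity does not increase on average along a protocol. On unit vectors it
equals |exp((1-\<alpha>)/\<alpha> E\<^sub>\<alpha>) - 1|, respectively the entropy; both increase with the entanglement entropy,
so Markov's inequality gives the bound.
*)

theory Submission
  imports Defs "HOL-Analysis.Convex" "Jordan_Normal_Form.Spectral_Radius"
begin

subsection \<open>A superadditive functional on nonnegative vectors\<close>

text \<open>The sign makes this concave on \<open>x \<ge> 0\<close> for every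
  \<open>\<alpha> > 0\<close>, because the power itself is concave below exponent 1 and convex above
  it. One Jensen argument then serves all cases.\<close>

definition renyi_summand :: "real \<Rightarrow> real \<Rightarrow> real" where
  "renyi_summand \<alpha> x = (if \<alpha> = 1 then - x * ln x else sgn (1 - \<alpha>) * x powr \<alpha>)"

text \<open>For \<open>\<alpha> \<noteq> 1\<close> this is the gap between the (quasi-)norm of
  exponent \<open>\<alpha>\<close> and the 1-norm, signed so as to be nonnegative. For
  \<open>\<alpha> = 1\<close> and total \<open>t > 0\<close> it is \<open>t\<close> times the
  Shannon entropy of \<open>d / t\<close>. Both are homogeneous of degree one.\<close>

definition renyi_excess :: "real \<Rightarrow> 'i set \<Rightarrow> ('i \<Rightarrow> real) \<Rightarrow> real" where
  "renyi_excess \<alpha> I d =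
     (if \<alpha> = 1 then (\<Sum>i\<in>I. - d i * ln (d i)) + (\<Sum>i\<in>I. d i) * ln (\<Sum>i\<in>I. d i)
      else sgn (1 - \<alpha>) * ((\<Sum>i\<in>I. d i powr \<alpha>) powr (1 / \<alpha>) - (\<Sum>i\<in>I. d i)))"

section \<open>Tangent lines and concavity of the summand\<close>

lemma renyi_summand_0 [simp]: "renyi_summand \<alpha> 0 = 0"
  by (simp add: renyi_summand_def)

text \<open>Weighted arithmetic-geometric mean inequality for \<open>z\<close> and 1 with weights
  \<open>\<beta>\<close> and \<open>1 - \<beta>\<close>.\<close>

lemma powr_le_tangent:
  fixes z \<beta> :: real
  assumes "0 \<le> z" "0 < \<beta>" "\<beta> < 1"
  shows "z powr \<beta> \<le> 1 + \<beta> * (z - 1)"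
  using Youngs_inequality_0[of \<beta> "1 - \<beta>" z 1] assms
  by (cases "z = 0") (simp_all add: algebra_simps)

text \<open>The previous bound with exponent \<open>1 / \<beta>\<close>, applied to the value
  \<open>w\<close> of the tangent line and raised to the power \<open>\<beta>\<close>. Where the
  tangent line is negative the claim is trivial.\<close>

lemma powr_ge_tangent:
  fixes z \<beta> :: real
  assumes "0 \<le> z" "1 < \<beta>"
  shows "1 + \<beta> * (z - 1) \<le> z powr \<beta>"
proof (cases "0 \<le> 1 + \<beta> * (z - 1)")
  case True
  define w where "w = 1 + \<beta> * (z - 1)"
  have "w powr (1 / \<beta>) \<le> z"
    using powr_le_tangent[of w "1 / \<beta>"] assms True by (simp add: w_def)
  then have "(w powr (1 / \<beta>)) powr \<beta> \<le> z powr \<beta>"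
    using assms by (intro powr_mono2) auto
  then show ?thesis using assms True by (simp add: powr_powr w_def)
next
  case False
  then show ?thesis using powr_ge_zero[of z \<beta>] by linarith
qed

text \<open>The slope \<open>c\<close> is the derivative at \<open>y\<close>. The point
  \<open>y = 0\<close> has to be excluded, since for \<open>\<alpha> \<le> 1\<close> the derivative
  is infinite there.\<close>

lemma renyi_summand_tangent:
  assumes "0 < \<alpha>" "0 < y"
  shows "\<exists>c. \<forall>x\<ge>0. renyi_summand \<alpha> x \<le> renyi_summand \<alpha> y + c * (x - y)"
proof (cases "\<alpha> = 1")
  case True
  have "- x * ln x \<le> - y * ln y + (- ln y - 1) * (x - y)" if "0 \<le> x" for x
  proof (cases "x = 0")
    case False
    \<comment> \<open>This is \<open>ln u \<le> u - 1\<close> at \<open>u = y / x\<close>,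
      multiplied by \<open>x\<close>.\<close>
    then have "x * ln (y / x) \<le> x * (y / x - 1)"
      using that assms by (intro mult_left_mono ln_le_minus_one) auto
    then show ?thesis using that False assms by (simp add: ln_div algebra_simps)
  qed (use assms in \<open>simp add: algebra_simps\<close>)
  then show ?thesis using True unfolding renyi_summand_def by auto
next
  case False
  have *: "sgn (1 - \<alpha>) * z powr \<alpha> \<le> sgn (1 - \<alpha>) * (1 + \<alpha> * (z - 1))" if "0 \<le> z" for z
    using powr_le_tangent[OF that, of \<alpha>] powr_ge_tangent[OF that, of \<alpha>] False assms
    by (cases "\<alpha> < 1") auto
  have "sgn (1 - \<alpha>) * x powr \<alpha> \<le> sgn (1 - \<alpha>) * y powr \<alpha> +
      (sgn (1 - \<alpha>) * \<alpha> * y powr \<alpha> / y) * (x - y)" if "0 \<le> x" for x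
  proof -
    \<comment> \<open>Homogeneity of the power reduces the tangent at \<open>y\<close> to the
      tangent at 1, taken at the point \<open>x / y\<close>.\<close>
    have "sgn (1 - \<alpha>) * x powr \<alpha> = y powr \<alpha> * (sgn (1 - \<alpha>) * (x / y) powr \<alpha>)"
      using assms that by (simp add: powr_divide)
    also have "\<dots> \<le> y powr \<alpha> * (sgn (1 - \<alpha>) * (1 + \<alpha> * (x / y - 1)))"
      by (rule mult_left_mono[OF *]) (use assms that in auto)
    also have "\<dots> = sgn (1 - \<alpha>) * y powr \<alpha> + (sgn (1 - \<alpha>) * \<alpha> * y powr \<alpha> / y) * (x - y)"
      using assms by (simp add: field_simps)
    finally show ?thesis .
  qed
  then have "\<exists>c. \<forall>x\<ge>0. sgn (1 - \<alpha>) * x powr \<alpha> \<le> sgn (1 - \<alpha>) * y powr \<alpha> + c * (x - y)" by blast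
  then show ?thesis using False unfolding renyi_summand_def by simp
qed

text \<open>Average the tangent line at the mean \<open>y\<close>: its linear term cancels. If the
  mean is 0 there is no tangent, but then every point of positive weight is 0.\<close>

lemma renyi_summand_jensen:
  assumes "0 < \<alpha>" and w: "\<And>k. k \<in> K \<Longrightarrow> 0 \<le> w k" "sum w K = 1"
    and x: "\<And>k. k \<in> K \<Longrightarrow> 0 \<le> x k"
  shows "(\<Sum>k\<in>K. w k * renyi_summand \<alpha> (x k)) \<le> renyi_summand \<alpha> (\<Sum>k\<in>K. w k * x k)"
proof -
  define y where "y = (\<Sum>k\<in>K. w k * x k)"
  \<comment> \<open>Sums over infinite sets are 0 by convention, so total weight 1 already forces
    finiteness.\<close>
  have fin: "finite K" using w(2) by (metis sum.infinite zero_neq_one)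
  have "0 \<le> y" unfolding y_def using w x by (intro sum_nonneg) auto
  then consider "y = 0" | "0 < y" by fastforce
  then have "(\<Sum>k\<in>K. w k * renyi_summand \<alpha> (x k)) \<le> renyi_summand \<alpha> y"
  proof cases
    case 1
    then have "w k * x k = 0" if "k \<in> K" for k
      using fin w x that unfolding y_def by (subst (asm) sum_nonneg_eq_0_iff) auto
    then have "w k * renyi_summand \<alpha> (x k) = 0" if "k \<in> K" for k using that by fastforce
    then show ?thesis using 1 by (simp add: sum.neutral del: mult_eq_0_iff)
  next
    case 2
    then obtain c where c: "\<And>z. z \<ge> 0 \<Longrightarrow> renyi_summand \<alpha> z \<le> renyi_summand \<alpha> y + c * (z - y)"
      using renyi_summand_tangent assms(1) by blast
    have "(\<Sum>k\<in>K. w k * renyi_summand \<alpha> (x k)) \<le> (\<Sum>k\<in>K. w k * (renyi_summand \<alpha> y + c * (x k - y)))"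
      using c w x by (intro sum_mono mult_left_mono) auto
    also have "\<dots> = sum w K * (renyi_summand \<alpha> y - c * y) + c * (\<Sum>k\<in>K. w k * x k)"
      by (simp add: algebra_simps sum.distrib sum_distrib_left sum_distrib_right sum_subtractf)
    finally show ?thesis using w by (simp flip: y_def)
  qed
  then show ?thesis unfolding y_def .
qed

lemma renyi_summand_concave:
  assumes "0 < \<alpha>" "0 \<le> x" "0 \<le> y" "0 \<le> t" "t \<le> 1"
  shows "t * renyi_summand \<alpha> x + (1 - t) * renyi_summand \<alpha> y \<le> renyi_summand \<alpha> (t * x + (1 - t) * y)"
  using renyi_summand_jensen[of \<alpha> UNIV "\<lambda>b. if b then t else 1 - t" "\<lambda>b. if b then x else y"] assms
  by (simp add: UNIV_bool algebra_simps)

text \<open>At a fixed total the excess is an increasing function of the sum of the summands. For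
  \<open>\<alpha> > 1\<close> the sign reverses the order of the power sums, and reverses it back in
  the excess. The index sets may differ, which allows spectra of different lengths to be
  compared.\<close>

lemma renyi_excess_mono:
  assumes "0 < \<alpha>" "sum d I = sum e I'" 
    and le: "(\<Sum>i\<in>I. renyi_summand \<alpha> (d i)) \<le> (\<Sum>i\<in>I'. renyi_summand \<alpha> (e i))"
  shows "renyi_excess \<alpha> I d \<le> renyi_excess \<alpha> I' e"
proof -
  consider "\<alpha> = 1" | "\<alpha> < 1" | "1 < \<alpha>" by linarith
  then show ?thesis
  proof cases
    case 1
    then show ?thesis using assms by (simp add: renyi_excess_def renyi_summand_def)
  next
    case 2
    then have "(\<Sum>i\<in>I. d i powr \<alpha>) \<le> (\<Sum>i\<in>I'. e i powr \<alpha>)"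
      using le by (simp add: renyi_summand_def)
    then have "(\<Sum>i\<in>I. d i powr \<alpha>) powr (1/\<alpha>) \<le> (\<Sum>i\<in>I'. e i powr \<alpha>) powr (1/\<alpha>)"
      using assms by (intro powr_mono2) (auto intro: sum_nonneg)
    then show ?thesis using 2 assms by (simp add: renyi_excess_def)
  next
    case 3
    then have "(\<Sum>i\<in>I'. e i powr \<alpha>) \<le> (\<Sum>i\<in>I. d i powr \<alpha>)"
      using le by (simp add: renyi_summand_def sum_negf)
    then have "(\<Sum>i\<in>I'. e i powr \<alpha>) powr (1/\<alpha>) \<le> (\<Sum>i\<in>I. d i powr \<alpha>) powr (1/\<alpha>)"
      using assms by (intro powr_mono2) (auto intro: sum_nonneg)
    then show ?thesis using 3 assms by (simp add: renyi_excess_def)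
  qed
qed

section \<open>Homogeneity, positivity and superadditivity of the excess\<close>

lemma renyi_excess_cong:
  "(\<And>i. i \<in> I \<Longrightarrow> d i = e i) \<Longrightarrow> renyi_excess \<alpha> I d = renyi_excess \<alpha> I e"
  by (simp add: renyi_excess_def cong: sum.cong)

text \<open>For \<open>\<alpha> = 1\<close> the terms with \<open>ln c\<close> coming from the
  entries and from the total cancel; this is why the total enters the definition with its
  logarithm.\<close>

lemma renyi_excess_scale:
  assumes "0 < \<alpha>" "0 \<le> c" "\<And>i. i \<in> I \<Longrightarrow> 0 \<le> d i"
  shows "renyi_excess \<alpha> I (\<lambda>i. c * d i) = c * renyi_excess \<alpha> I d"
proof (cases "c = 0")
  case True
  then show ?thesis by (simp add: renyi_excess_def)
next
  case False
  have ln: "c * x * ln (c * x) = c * ln c * x + c * (x * ln x)" if "0 \<le> x" for x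
    using that False assms by (cases "x = 0") (auto simp: ln_mult algebra_simps)
  have pos: "0 \<le> sum d I" using assms by (intro sum_nonneg) auto
  have "(\<Sum>i\<in>I. c * d i * ln (c * d i)) = (\<Sum>i\<in>I. c * ln c * d i + c * (d i * ln (d i)))"
    using assms ln by (intro sum.cong) auto
  moreover have "(c * sum d I) * ln (c * sum d I) = c * ln c * sum d I + c * (sum d I * ln (sum d I))"
    using ln[OF pos] .
  moreover have "((\<Sum>i\<in>I. (c * d i) powr \<alpha>)) powr (1/\<alpha>) = c * (\<Sum>i\<in>I. d i powr \<alpha>) powr (1/\<alpha>)"
    using assms by (simp add: powr_mult powr_powr sum_nonneg flip: sum_distrib_left cong: sum.cong)
  ultimately show ?thesis
    by (simp add: renyi_excess_def sum_negf sum.distrib algebra_simps flip: sum_distrib_left)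
qed

text \<open>Rescale to total 1. The entries then lie between 0 and 1, and concavity between these
  endpoints shows that the excess is at least that of a point mass, which is 0.\<close>

lemma renyi_excess_nonneg:
  assumes \<alpha>: "0 < \<alpha>" and I: "finite I" and d: "\<And>i. i \<in> I \<Longrightarrow> 0 \<le> d i"
  shows "0 \<le> renyi_excess \<alpha> I d"
proof (cases "sum d I = 0")
  case True
  then have "d i = 0" if "i \<in> I" for i using I d that by (simp add: sum_nonneg_eq_0_iff)
  then show ?thesis by (simp add: renyi_excess_def cong: sum.cong)
next
  case False
  define t where "t = sum d I"
  define u where "u i = d i / t" for i
  have t: "0 < t" using False sum_nonneg[of I d] d by (simp add: t_def less_le)
  have u: "0 \<le> u i" if "i \<in> I" for i using d that t by (simp add: u_def)
  have u1: "sum u I = 1" using t by (simp add: u_def flip: sum_divide_distrib t_def)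
  have "u i * renyi_summand \<alpha> 1 \<le> renyi_summand \<alpha> (u i)" if "i \<in> I" for i
    using renyi_summand_concave[of \<alpha> 1 0 "u i"] \<alpha> I u member_le_sum[of i I u] that u1 by simp
  then have "(\<Sum>i\<in>I. u i * renyi_summand \<alpha> 1) \<le> (\<Sum>i\<in>I. renyi_summand \<alpha> (u i))"
    by (rule sum_mono)
  then have "renyi_excess \<alpha> {()} (\<lambda>_. 1) \<le> renyi_excess \<alpha> I u"
    using \<alpha> u1 by (intro renyi_excess_mono) (auto simp flip: sum_distrib_right)
  moreover have "renyi_excess \<alpha> {()} (\<lambda>_. 1) = 0" by (simp add: renyi_excess_def)
  moreover have "renyi_excess \<alpha> I d = t * renyi_excess \<alpha> I u"
    using renyi_excess_scale[of \<alpha> t I u] \<alpha> t u by (simp add: u_def)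
  ultimately show ?thesis using t by simp
qed

text \<open>For \<open>\<alpha> \<noteq> 1\<close> this is Minkowski's inequality, reversed when
  \<open>\<alpha> < 1\<close>, since the 1-norm part is additive. All cases follow by rescaling both
  vectors to norm 1 and using concavity of the summand on their mixture.\<close>

lemma renyi_excess_superadditive:
  assumes \<alpha>: "0 < \<alpha>" and I: "finite I" and d: "\<And>i. i \<in> I \<Longrightarrow> 0 \<le> d i" and e: "\<And>i. i \<in> I \<Longrightarrow> 0 \<le> e i"
  shows "renyi_excess \<alpha> I d + renyi_excess \<alpha> I e \<le> renyi_excess \<alpha> I (\<lambda>i. d i + e i)"
proof -
  \<comment> \<open>The normalizer: the total for \<open>\<alpha> = 1\<close>, where the excess of a
    vector of total 1 is its sum of summands, and otherwise the (quasi-)norm, where a vector of norm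
    1 has power sum 1.\<close>
  define nrm where "nrm u = (if \<alpha> = 1 then sum u I else (\<Sum>i\<in>I. u i powr \<alpha>) powr (1/\<alpha>))" for u
  have nrm0: "u i = 0" if "nrm u = 0" "\<And>i. i \<in> I \<Longrightarrow> 0 \<le> u i" "i \<in> I" for u i
    using that I \<alpha> by (auto simp: nrm_def sum_nonneg_eq_0_iff split: if_splits)
  have nrm_pos: "0 \<le> nrm u" if "\<And>i. i \<in> I \<Longrightarrow> 0 \<le> u i" for u
    using that by (auto simp: nrm_def sum_nonneg)
  have zero: "renyi_excess \<alpha> I (\<lambda>_. 0) = 0" by (simp add: renyi_excess_def)
  \<comment> \<open>A vanishing normalizer forces the vector to vanish; only the last case permits
    rescaling.\<close>
  consider "nrm d = 0" | "nrm e = 0" | "0 < nrm d" "0 < nrm e"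
    using nrm_pos[of d] nrm_pos[of e] d e by fastforce
  then show ?thesis
  proof cases
    case 1
    then have "renyi_excess \<alpha> I d = 0" "renyi_excess \<alpha> I (\<lambda>i. d i + e i) = renyi_excess \<alpha> I e"
      using nrm0[of d] d zero by (auto simp: cong: renyi_excess_cong)
    then show ?thesis by simp
  next
    case 2
    then have "renyi_excess \<alpha> I e = 0" "renyi_excess \<alpha> I (\<lambda>i. d i + e i) = renyi_excess \<alpha> I d"
      using nrm0[of e] e zero by (auto simp: cong: renyi_excess_cong)
    then show ?thesis by simp
  next
    case 3
    define D where "D = nrm d"
    define E where "E = nrm e"
    \<comment> \<open>This weight turns the mixture of \<open>d / D\<close> and \<open>e / E\<close>
      into \<open>(d + e) / (D + E)\<close>.\<close>
    define t where "t = D / (D + E)"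
    have DE: "0 < D" "0 < E" and t: "0 \<le> t" "t \<le> 1" "1 - t = E / (D + E)"
      using 3 by (auto simp: D_def E_def t_def field_simps)
    have mix: "t * (\<Sum>i\<in>I. renyi_summand \<alpha> (d i / D)) + (1 - t) * (\<Sum>i\<in>I. renyi_summand \<alpha> (e i / E))
        \<le> (\<Sum>i\<in>I. renyi_summand \<alpha> ((d i + e i) / (D + E)))"
    proof -
      have "t * (d i / D) + (1 - t) * (e i / E) = (d i + e i) / (D + E)" for i
        using DE unfolding t(3) by (simp add: t_def add_divide_distrib)
      then have "t * renyi_summand \<alpha> (d i / D) + (1 - t) * renyi_summand \<alpha> (e i / E)
          \<le> renyi_summand \<alpha> ((d i + e i) / (D + E))" if "i \<in> I" for i
        using renyi_summand_concave[of \<alpha> "d i / D" "e i / E" t] \<alpha> t d e DE that by simp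
      then show ?thesis unfolding sum_distrib_left sum.distrib[symmetric] by (rule sum_mono)
    qed
    have sc: "renyi_excess \<alpha> I u = c * renyi_excess \<alpha> I (\<lambda>i. u i / c)"
      if "\<And>i. i \<in> I \<Longrightarrow> 0 \<le> u i" "0 < c" for u c
      using renyi_excess_scale[of \<alpha> c I "\<lambda>i. u i / c"] that \<alpha> by simp
    show ?thesis
    proof (cases "\<alpha> = 1")
      case True
      have one: "(\<Sum>i\<in>I. d i / D) = 1" "(\<Sum>i\<in>I. e i / E) = 1" "(\<Sum>i\<in>I. (d i + e i) / (D + E)) = 1"
        using DE True unfolding sum_divide_distrib[symmetric] 
        by (auto simp: D_def E_def nrm_def sum.distrib)
      have ren: "renyi_excess \<alpha> I u = (\<Sum>i\<in>I. renyi_summand \<alpha> (u i))" if "sum u I = 1" for u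
        using True that by (simp add: renyi_excess_def renyi_summand_def)
      have "renyi_excess \<alpha> I d + renyi_excess \<alpha> I e =
         (D + E) * (t * renyi_excess \<alpha> I (\<lambda>i. d i / D) + (1 - t) * renyi_excess \<alpha> I (\<lambda>i. e i / E))"
        using sc[of d D] sc[of e E] d e DE unfolding t(3) by (simp add: t_def distrib_left)
      also have "\<dots> \<le> (D + E) * renyi_excess \<alpha> I (\<lambda>i. (d i + e i) / (D + E))"
        using mix DE by (intro mult_left_mono) (auto simp: ren one)
      also have "\<dots> = renyi_excess \<alpha> I (\<lambda>i. d i + e i)"
        using sc[of "\<lambda>i. d i + e i" "D + E"] d e DE by simp
      finally show ?thesis .
    next
      case False
      have one: "(\<Sum>i\<in>I. (u i / c) powr \<alpha>) = (nrm u / c) powr \<alpha>"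
        if "\<And>i. i \<in> I \<Longrightarrow> 0 \<le> u i" "0 < c" for u c
        using that \<alpha> False
        by (simp add: nrm_def powr_divide powr_powr sum_nonneg sum_divide_distrib cong: sum.cong)
      have ren: "(\<Sum>i\<in>I. renyi_summand \<alpha> (u i)) = sgn (1 - \<alpha>) * (\<Sum>i\<in>I. u i powr \<alpha>)" for u
        using False by (simp add: renyi_summand_def sum_distrib_left)
      define M where "M = nrm (\<lambda>i. d i + e i)"
      have M: "0 \<le> M" unfolding M_def using d e by (intro nrm_pos) auto
      \<comment> \<open>Both rescaled vectors have power sum 1, so the left side of
        \<open>mix\<close> collapses to the sign. Taking the root afterwards compares
        \<open>M\<close> with \<open>D + E\<close>.\<close>
      have "sgn (1 - \<alpha>) \<le> sgn (1 - \<alpha>) * (M / (D + E)) powr \<alpha>"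
        using mix one[of d D] one[of e E] one[of "\<lambda>i. d i + e i" "D + E"] d e DE 
        by (simp add: ren M_def flip: D_def E_def) (simp add: algebra_simps)
      then have "sgn (1 - \<alpha>) * (D + E) \<le> sgn (1 - \<alpha>) * M"
      proof (cases "\<alpha> < 1")
        case True
        assume "sgn (1 - \<alpha>) \<le> sgn (1 - \<alpha>) * (M / (D + E)) powr \<alpha>"
        then have "1 \<le> (M / (D + E)) powr \<alpha>" using True by simp
        then have "1 \<le> M / (D + E)" using \<alpha> M DE
          using powr_less_mono2[of \<alpha> "M / (D + E)" 1] by fastforce
        then show ?thesis using True DE by (simp add: field_simps)
      next
        case F: False
        assume "sgn (1 - \<alpha>) \<le> sgn (1 - \<alpha>) * (M / (D + E)) powr \<alpha>"
        then have "(M / (D + E)) powr \<alpha> \<le> 1" using F False by simp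
        then have "M / (D + E) \<le> 1" using \<alpha> M DE
          using powr_less_mono2[of \<alpha> 1 "M / (D + E)"] by fastforce
        then show ?thesis using F False DE by (simp add: field_simps)
      qed
      moreover have "renyi_excess \<alpha> I u = sgn (1 - \<alpha>) * nrm u - sgn (1 - \<alpha>) * sum u I" for u
        using False by (simp add: renyi_excess_def nrm_def algebra_simps)
      ultimately show ?thesis
        unfolding M_def D_def E_def by (simp add: sum.distrib distrib_left)
    qed
  qed
qed

text \<open>Unit column sums preserve the total; unit row sums permit Jensen's inequality in each
  component.\<close>

lemma renyi_excess_mixing:
  assumes \<alpha>: "0 < \<alpha>" and S: "\<And>i k. i \<in> I \<Longrightarrow> k \<in> K \<Longrightarrow> 0 \<le> S i k"
    and row: "\<And>i. i \<in> I \<Longrightarrow> (\<Sum>k\<in>K. S i k) = 1" and col: "\<And>k. k \<in> K \<Longrightarrow> (\<Sum>i\<in>I. S i k) = 1"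
    and d: "\<And>k. k \<in> K \<Longrightarrow> 0 \<le> d k"
  shows "renyi_excess \<alpha> K d \<le> renyi_excess \<alpha> I (\<lambda>i. \<Sum>k\<in>K. S i k * d k)"
proof (rule renyi_excess_mono[OF \<alpha>])
  have swap: "(\<Sum>i\<in>I. \<Sum>k\<in>K. S i k * g k) = sum g K" for g :: "_ \<Rightarrow> real"
    by (subst sum.swap) (simp add: col flip: sum_distrib_right)
  show "sum d K = (\<Sum>i\<in>I. \<Sum>k\<in>K. S i k * d k)" by (simp add: swap)
  have "(\<Sum>k\<in>K. renyi_summand \<alpha> (d k)) = (\<Sum>i\<in>I. \<Sum>k\<in>K. S i k * renyi_summand \<alpha> (d k))"
    by (simp add: swap)
  also have "\<dots> \<le> (\<Sum>i\<in>I. renyi_summand \<alpha> (\<Sum>k\<in>K. S i k * d k))"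
    using S row d \<alpha> by (intro sum_mono renyi_summand_jensen) auto
  finally show "(\<Sum>k\<in>K. renyi_summand \<alpha> (d k)) \<le> \<dots>" .
qed

text \<open>Applied with \<open>C i k = |\<langle>v\<^sub>i|M u\<^sub>k\<rangle>|\<^sup>2\<close> for eigenbases \<open>v\<close> of \<open>M M\<^sup>\<dagger>\<close> and \<open>u\<close> of \<open>M\<^sup>\<dagger> M\<close>: it identifies
  the two spectra up to zeros, without singular value decomposition.\<close>

lemma renyi_excess_coupling:
  fixes C :: "'i \<Rightarrow> 'k \<Rightarrow> real"
  assumes \<alpha>: "0 < \<alpha>"
    and row: "\<And>i. i \<in> I \<Longrightarrow> (\<Sum>k\<in>K. C i k) = e i" and col: "\<And>k. k \<in> K \<Longrightarrow> (\<Sum>i\<in>I. C i k) = d k"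
    and eq: "\<And>i k. i \<in> I \<Longrightarrow> k \<in> K \<Longrightarrow> C i k = 0 \<or> e i = d k"
  shows "renyi_excess \<alpha> K d = renyi_excess \<alpha> I e"
proof -
  have *: "(\<Sum>k\<in>K. g (d k)) = (\<Sum>i\<in>I. g (e i))" if "g 0 = 0" for g :: "real \<Rightarrow> real"
  proof -
    \<comment> \<open>Division by 0 yields 0, so the assumption \<open>g 0 = 0\<close> covers the
      vanishing eigenvalues. The factor \<open>x\<close> is then spread out as a row or column sum
      of \<open>C\<close>.\<close>
    have g: "g x = x * (g x / x)" for x using that by (cases "x = 0") auto
    have "(\<Sum>k\<in>K. g (d k)) = (\<Sum>k\<in>K. \<Sum>i\<in>I. C i k * (g (d k) / d k))"
    proof (intro sum.cong refl)
      fix k assume "k \<in> K"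
      then show "g (d k) = (\<Sum>i\<in>I. C i k * (g (d k) / d k))"
        using g[of "d k"] by (simp only: col flip: sum_distrib_right)
    qed
    \<comment> \<open>Wherever \<open>C i k\<close> does not vanish, the two values agree.\<close>
    also have "\<dots> = (\<Sum>k\<in>K. \<Sum>i\<in>I. C i k * (g (e i) / e i))"
      by (intro sum.cong refl) (use eq in fastforce)
    also have "\<dots> = (\<Sum>i\<in>I. \<Sum>k\<in>K. C i k * (g (e i) / e i))" by (rule sum.swap)
    also have "\<dots> = (\<Sum>i\<in>I. g (e i))"
    proof (intro sum.cong refl)
      fix i assume "i \<in> I"
      then show "(\<Sum>k\<in>K. C i k * (g (e i) / e i)) = g (e i)"
        using g[of "e i"] by (simp only: row flip: sum_distrib_right)
    qed
    finally show ?thesis .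
  qed
  show ?thesis
    \<comment> \<open>The choice \<open>id\<close> matches the totals and
      \<open>renyi_summand \<alpha>\<close> the sums of summands, in both directions.\<close>
    by (rule antisym; rule renyi_excess_mono[OF \<alpha>]) (use *[of id] *[of "renyi_summand \<alpha>"] in auto)
qed

lemma renyi_excess_sum_list:
  assumes "0 < \<alpha>" "finite I" "\<And>x i. x \<in> set xs \<Longrightarrow> i \<in> I \<Longrightarrow> 0 \<le> y x i"
  shows "(\<Sum>x\<leftarrow>xs. renyi_excess \<alpha> I (y x)) \<le> renyi_excess \<alpha> I (\<lambda>i. \<Sum>x\<leftarrow>xs. y x i)"
  using assms(3)
proof (induction xs)
  case (Cons x xs)
  have "0 \<le> (\<Sum>x\<leftarrow>xs. y x i)" if "i \<in> I" for i
    using Cons.prems that by (intro sum_list_nonneg) auto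
  then have "renyi_excess \<alpha> I (y x) + renyi_excess \<alpha> I (\<lambda>i. \<Sum>x\<leftarrow>xs. y x i)
      \<le> renyi_excess \<alpha> I (\<lambda>i. y x i + (\<Sum>x\<leftarrow>xs. y x i))"
    using Cons.prems[of x] by (intro renyi_excess_superadditive assms(1,2)) simp_all
  then show ?case using Cons by fastforce
qed (simp add: renyi_excess_def)

subsection \<open>Diagonalization of Hermitian matrices\<close>

lemma dim_mat_adjoint [simp]:
  "dim_row (mat_adjoint A) = dim_col A" "dim_col (mat_adjoint A) = dim_row A"
  by (simp_all add: mat_adjoint_def)

lemma index_mat_adjoint [simp]:
  fixes A :: "complex mat"
  shows "i < dim_col A \<Longrightarrow> j < dim_row A \<Longrightarrow> mat_adjoint A $$ (i, j) = cnj (A $$ (j, i))"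
  by (simp add: mat_adjoint_def mat_of_rows_def)

lemma mat_adjoint_mat_adjoint [simp]: "mat_adjoint (mat_adjoint (A :: complex mat)) = A"
  by (intro eq_matI) auto

lemma mat_adjoint_mult:
  fixes A B :: "complex mat"
  assumes "dim_col A = dim_row B"
  shows "mat_adjoint (A * B) = mat_adjoint B * mat_adjoint A"
  using assms by (intro eq_matI) (auto simp: scalar_prod_def mult.commute)

lemma dim_mat_diag [simp]: "dim_row (mat_diag n f) = n" "dim_col (mat_diag n f) = n"
  by (simp_all add: mat_diag_def)

lemma assoc_mult_mat_dim:
  fixes A B C :: "'a :: semiring_0 mat"
  assumes "dim_col A = dim_row B" "dim_col B = dim_row C"
  shows "A * B * C = A * (B * C)"
  using assms by (intro assoc_mult_mat[of _ "dim_row A" "dim_row B" _ "dim_row C" _ "dim_col C"]) auto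

lemma mult_mat_diag_adjoint_index:
  fixes T :: "complex mat"
  assumes T: "T \<in> carrier_mat m n" and ij: "i < m" "j < m"
  shows "(T * mat_diag n f * mat_adjoint T) $$ (i, j) = (\<Sum>k<n. T $$ (i, k) * f k * cnj (T $$ (j, k)))"
  using assms by (subst mat_diag_mult_right[OF T]) (auto simp: scalar_prod_def atLeast0LessThan)

lemma mult_adjoint_index:
  fixes T :: "complex mat"
  assumes T: "T \<in> carrier_mat m n" and ij: "i < m" "j < m"
  shows "(T * mat_adjoint T) $$ (i, j) = (\<Sum>k<n. T $$ (i, k) * cnj (T $$ (j, k)))"
  using assms by (auto simp: scalar_prod_def atLeast0LessThan)

lemma mult_adjoint_diag_entry:
  assumes "T \<in> carrier_mat m n" "i < m"
  shows "(T * mat_adjoint T) $$ (i, i) = complex_of_real (\<Sum>k<n. (cmod (T $$ (i, k)))\<^sup>2)"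
  using assms by (simp only: mult_adjoint_index of_real_sum complex_norm_square)

text \<open>Complete \<open>v\<close> to a basis with \<open>v\<close> in front, orthogonalize by
  Gram-Schmidt, which keeps the first vector, and normalize the columns.\<close>

lemma unitary_with_first_col:
  fixes v :: "complex vec"
  assumes v: "v \<in> carrier_vec n" and v0: "v \<noteq> 0\<^sub>v n"
  shows "\<exists>W c. W \<in> carrier_mat n n \<and> mat_adjoint W * W = 1\<^sub>m n \<and> col W 0 = c \<cdot>\<^sub>v v"
proof -
  interpret cof_vec_space n "TYPE(complex)" .
  define b where "b = basis_completion v"
  define ws where "ws = gram_schmidt n b"
  have n: "0 < n" using v v0 by (cases n) auto
  from basis_completion[OF v v0, folded b_def]
  have dist: "distinct b" and indep: "\<not> lin_dep (set b)" and b: "set b \<subseteq> carrier_vec n"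
    and hdb: "hd b = v" and len: "length b = n" by auto
  from hdb len n obtain vs where bv: "b = v # vs" by (cases b) auto
  from gram_schmidt_result[OF b dist indep refl, folded ws_def]
  have ws: "set ws \<subseteq> carrier_vec n" "corthogonal ws" "length ws = n" by (auto simp: len)
  have "hd ws = v" using gram_schmidt_hd[OF v, of vs, folded bv] unfolding ws_def .
  then have ws0: "ws ! 0 = v" using ws(3) n by (cases ws) auto
  \<comment> \<open>The Gram-Schmidt vectors are orthogonal but not normalized; \<open>r j\<close>
    is the norm of the \<open>j\<close>-th one.\<close>
  define r where "r j = sqrt (\<Sum>k<n. (cmod (ws ! j $ k))\<^sup>2)" for j
  define W where "W = mat n n (\<lambda>(k, j). complex_of_real (1 / r j) * ws ! j $ k)"
  have wsc: "ws ! j \<in> carrier_vec n" if "j < n" for j using ws that by auto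
  have ip: "ws ! j \<bullet>c ws ! i = (\<Sum>k<n. ws ! j $ k * cnj (ws ! i $ k))" if "i < n" "j < n" for i j
    using wsc[OF that(1)] wsc[OF that(2)] by (auto simp: scalar_prod_def atLeast0LessThan)
  have sq: "(\<Sum>k<n. ws ! j $ k * cnj (ws ! j $ k)) = complex_of_real ((r j)\<^sup>2)" for j
    by (simp only: r_def of_real_sum complex_norm_square real_sqrt_pow2 sum_nonneg zero_le_power2)
  have orth: "ws ! j \<bullet>c ws ! i = 0 \<longleftrightarrow> i \<noteq> j" if "i < n" "j < n" for i j
    using ws(2,3) that unfolding corthogonal_def by metis
  have r0: "r j \<noteq> 0" if "j < n" for j
    using orth[OF that that] ip[OF that that] sq[of j] by auto
  have "(mat_adjoint W * W) $$ (i, j) = 1\<^sub>m n $$ (i, j)" if ij: "i < n" "j < n" for i j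
  proof -
    have "(mat_adjoint W * W) $$ (i, j) =
        (\<Sum>k<n. complex_of_real (1 / r i) * complex_of_real (1 / r j) * (ws ! j $ k * cnj (ws ! i $ k)))"
      using ij by (auto simp: W_def scalar_prod_def atLeast0LessThan intro!: sum.cong)
    also have "\<dots> = complex_of_real (1 / r i) * complex_of_real (1 / r j) * (ws ! j \<bullet>c ws ! i)"
      unfolding ip[OF ij] by (simp only: sum_distrib_left)
    also have "\<dots> = 1\<^sub>m n $$ (i, j)"
    proof (cases "i = j")
      case True
      then show ?thesis using ij r0 ip[OF ij] sq[of j] by (simp add: power2_eq_square)
    next
      case False
      then show ?thesis using ij orth[OF ij] by simp
    qed
    finally show ?thesis .
  qed
  then have "mat_adjoint W * W = 1\<^sub>m n" by (intro eq_matI) (auto simp: W_def)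
  moreover have "col W 0 = complex_of_real (1 / r 0) \<cdot>\<^sub>v v"
    using n v by (intro eq_vecI) (auto simp: W_def ws0)
  moreover have "W \<in> carrier_mat n n" by (simp add: W_def)
  ultimately show ?thesis by blast
qed

lemma unitary_right_inverse:
  fixes U :: "complex mat"
  assumes "U \<in> carrier_mat n n" "mat_adjoint U * U = 1\<^sub>m n"
  shows "U * mat_adjoint U = 1\<^sub>m n"
  using mat_mult_left_right_inverse[OF mat_adjoint_carrier[OF assms(1)] assms] .

text \<open>Deflation: in an orthonormal basis starting with an eigenvector, a Hermitian matrix
  splits into a real 1 by 1 block and a Hermitian block of size one less, to which induction
  applies.\<close>

theorem hermitian_unitary_diagonalization:
  assumes "A \<in> carrier_mat n n" "mat_adjoint A = A"
  shows "\<exists>U d. unitary_diagonalization A U d"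
  using assms
proof (induction n arbitrary: A)
  case 0
  then have "unitary_diagonalization A (1\<^sub>m 0) (\<lambda>_. 0)"
    unfolding unitary_diagonalization_def Let_def by (auto intro!: eq_matI)
  then show ?case by blast
next
  case (Suc m)
  note A = Suc.prems(1)
  let ?n = "Suc m"
  from spectrum_non_empty[OF A] obtain e v where ev: "eigenvector A v e"
    unfolding spectrum_def eigenvalue_def by auto
  then have v: "v \<in> carrier_vec ?n" "v \<noteq> 0\<^sub>v ?n" and Av: "A *\<^sub>v v = e \<cdot>\<^sub>v v"
    using A by (auto simp: eigenvector_def)
  from unitary_with_first_col[OF v] obtain W c where W: "W \<in> carrier_mat ?n ?n"
    and W1: "mat_adjoint W * W = 1\<^sub>m ?n" and W0: "col W 0 = c \<cdot>\<^sub>v v" by blast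
  note W2 = unitary_right_inverse[OF W W1]
  note Wa = mat_adjoint_carrier[OF W]
  define A' where "A' = mat_adjoint W * (A * W)"
  have A': "A' \<in> carrier_mat ?n ?n" using A W Wa by (simp add: A'_def)
  have herm: "mat_adjoint A' = A'"
    using A W Wa Suc.prems(2) unfolding A'_def by (simp add: mat_adjoint_mult)
  have "col (A * W) 0 = A *\<^sub>v (c \<cdot>\<^sub>v v)" using col_mult2[OF A W, of 0] W0 by simp
  also have "\<dots> = e \<cdot>\<^sub>v col W 0"
    using A v Av by (simp add: W0 mult_mat_vec smult_smult_assoc mult.commute)
  finally have "col (A * W) 0 = e \<cdot>\<^sub>v col W 0" .
  then have "col A' 0 = mat_adjoint W *\<^sub>v (e \<cdot>\<^sub>v col W 0)"
    unfolding A'_def using col_mult2[OF Wa, of "A * W" ?n 0] A W by simp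
  also have "\<dots> = e \<cdot>\<^sub>v col (mat_adjoint W * W) 0"
    using W col_mult2[OF Wa W, of 0] mult_mat_vec[OF Wa, of "col W 0" e]
    by (simp add: carrier_vecI)
  finally have col0: "col A' 0 = e \<cdot>\<^sub>v col (1\<^sub>m ?n) 0" using W1 by simp
  have i0: "A' $$ (i, 0) = (if i = 0 then e else 0)" if "i < ?n" for i
    using arg_cong[OF col0, of "\<lambda>u. u $ i"] that A' by auto
  have sym: "cnj (A' $$ (j, i)) = A' $$ (i, j)" if "i < ?n" "j < ?n" for i j
    using arg_cong[OF herm, of "\<lambda>M. M $$ (i, j)"] that A' by simp
  \<comment> \<open>Hermitian symmetry makes the eigenvalue real, and below it transfers the zeros
    of the first column to the first row.\<close>
  have "cnj e = e" using sym[of 0 0] i0[of 0] by simp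
  then have e: "complex_of_real (Re e) = e" by (simp add: complex_eq_iff)
  have i0': "A' $$ (0, j) = (if j = 0 then e else 0)" if "j < ?n" for j
    using sym[OF _ that, of 0] by (simp add: i0[OF that] \<open>cnj e = e\<close> split: if_splits)
  define A3 where "A3 = mat m m (\<lambda>(i, j). A' $$ (Suc i, Suc j))"
  have A3: "A3 \<in> carrier_mat m m" "mat_adjoint A3 = A3"
    by (auto simp: A3_def sym intro!: eq_matI)
  from Suc.IH[OF this] obtain U d where "unitary_diagonalization A3 U d" by blast
  then have U: "U \<in> carrier_mat m m" "mat_adjoint U * U = 1\<^sub>m m"
    and A3U: "A3 = U * mat_diag m (\<lambda>i. complex_of_real (d i)) * mat_adjoint U"
    using A3 by (auto simp: unitary_diagonalization_def Let_def)
  define D where "D = mat_diag ?n (\<lambda>i. complex_of_real (case_nat (Re e) d i))"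
  define F where "F = four_block_mat (1\<^sub>m 1) (0\<^sub>m 1 m) (0\<^sub>m m 1) U"
  \<comment> \<open>The matrices \<open>F\<close>, \<open>D\<close> and \<open>A'\<close> are all
    direct sums of a scalar and an \<open>m\<close> by \<open>m\<close> block; \<open>mult\<close>
    lets the calculation proceed blockwise.\<close>
  let ?B = "\<lambda>a X. four_block_mat (a \<cdot>\<^sub>m 1\<^sub>m 1) (0\<^sub>m 1 m) (0\<^sub>m m 1) X"
  have F: "F \<in> carrier_mat ?n ?n" using U unfolding F_def by auto
  have F1: "F = ?B 1 U" by (auto simp: F_def)
  have Fa: "mat_adjoint F = ?B 1 (mat_adjoint U)"
    using U F unfolding F_def by (intro eq_matI) auto
  have D: "D = ?B e (mat_diag m (\<lambda>i. complex_of_real (d i)))"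
    using e by (intro eq_matI) (auto simp: D_def mat_diag_def split: nat.splits)
  have mult: "?B a X * ?B b Y = ?B (a * b) (X * Y)" if "X \<in> carrier_mat m m" "Y \<in> carrier_mat m m"
    for a b :: complex and X Y :: "complex mat"
    using that by (subst mult_four_block_mat[of _ 1 1 _ m _ m _ _ 1 _ m]) (simp_all, auto intro!: eq_matI simp: scalar_prod_def)
  have "F * D * mat_adjoint F = ?B e A3"
    unfolding Fa D A3U unfolding F1 using U mat_adjoint_carrier[OF U(1)]
    by (simp add: mult mult_carrier_mat[of _ m m _ m] del: One_nat_def)
  also have "\<dots> = A'"
  proof (intro eq_matI)
    fix i j assume "i < dim_row A'" "j < dim_col A'"
    then show "?B e A3 $$ (i, j) = A' $$ (i, j)"
      using A' i0[of i] i0'[of j] by (cases i; cases j) (simp_all add: A3_def)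
  qed (use A' A3 in auto)
  finally have A'F: "A' = F * D * mat_adjoint F" by simp
  have one: "?B (1::complex) (1\<^sub>m m) = 1\<^sub>m ?n" by (intro eq_matI) auto
  have FF: "mat_adjoint F * F = 1\<^sub>m ?n"
    unfolding Fa unfolding F1 using U mat_adjoint_carrier[OF U(1)]
    by (simp add: mult one del: One_nat_def)
  have Dc: "D \<in> carrier_mat ?n ?n" by (simp add: D_def)
  note Fac = mat_adjoint_carrier[OF F]
  define V where "V = W * F"
  have V: "V \<in> carrier_mat ?n ?n" using W F by (auto simp: V_def)
  have Va: "mat_adjoint V = mat_adjoint F * mat_adjoint W"
    unfolding V_def using W F by (simp add: mat_adjoint_mult)
  have "mat_adjoint V * V = mat_adjoint F * (mat_adjoint W * W) * F"
    unfolding Va unfolding V_def using W F Wa Fac by (simp add: assoc_mult_mat_dim)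
  then have V1: "mat_adjoint V * V = 1\<^sub>m ?n" using W1 FF right_mult_one_mat[OF Fac] by simp
  have "A = W * mat_adjoint W * A * (W * mat_adjoint W)"
    unfolding W2 using A by simp
  also have "\<dots> = W * A' * mat_adjoint W" using A W Wa by (simp add: assoc_mult_mat_dim A'_def)
  also have "\<dots> = V * D * mat_adjoint V"
    unfolding Va unfolding A'F V_def using W F Wa Fac Dc by (simp add: assoc_mult_mat_dim)
  finally have "unitary_diagonalization A V (case_nat (Re e) d)"
    unfolding unitary_diagonalization_def Let_def D_def
    using V V1 unitary_right_inverse[OF V V1] A by simp
  then show ?case by blast
qed

subsection \<open>The functional on matrices\<close>

text \<open>Eigenvalues with multiplicity, in an arbitrary order; \<open>schmidt_excess_eqI\<close>
  shows that the excess does not depend on this choice.\<close>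

definition hermitian_spectrum :: "complex mat \<Rightarrow> nat \<Rightarrow> real" where
  "hermitian_spectrum A = (SOME d. \<exists>U. unitary_diagonalization A U d)"

text \<open>For a coefficient matrix, \<open>M * mat_adjoint M\<close> is the reduced operator on B,
  and its eigenvalues are the squared Schmidt coefficients, padded by zeros.\<close>

definition schmidt_excess :: "real \<Rightarrow> complex mat \<Rightarrow> real" where
  "schmidt_excess \<alpha> M = renyi_excess \<alpha> {..<dim_row M} (hermitian_spectrum (M * mat_adjoint M))"

lemma gram_unitary_diagonalization:
  "\<exists>U. unitary_diagonalization (M * mat_adjoint M) U (hermitian_spectrum (M * mat_adjoint M))"
proof -
  have "mat_adjoint (M * mat_adjoint M) = M * mat_adjoint M"
    by (simp add: mat_adjoint_mult)
  then have "\<exists>U d. unitary_diagonalization (M * mat_adjoint M) U d"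
    by (intro hermitian_unitary_diagonalization[of _ "dim_row M"]) auto
  then have "\<exists>d U. unitary_diagonalization (M * mat_adjoint M) U d" by blast
  then show ?thesis unfolding hermitian_spectrum_def by (rule someI_ex)
qed

lemma unitary_diagonalizationD:
  assumes "unitary_diagonalization A U d" "A \<in> carrier_mat n n"
  shows "U \<in> carrier_mat n n" "mat_adjoint U * U = 1\<^sub>m n" "U * mat_adjoint U = 1\<^sub>m n"
    "A = U * mat_diag n (\<lambda>i. complex_of_real (d i)) * mat_adjoint U"
    "mat_adjoint U * A * U = mat_diag n (\<lambda>i. complex_of_real (d i))"
proof -
  show U: "U \<in> carrier_mat n n" "mat_adjoint U * U = 1\<^sub>m n" "U * mat_adjoint U = 1\<^sub>m n"
    and A: "A = U * mat_diag n (\<lambda>i. complex_of_real (d i)) * mat_adjoint U"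
    using assms by (auto simp: unitary_diagonalization_def Let_def)
  note Ua = mat_adjoint_carrier[OF U(1)]
  define D where "D = mat_diag n (\<lambda>i. complex_of_real (d i))"
  have D: "D \<in> carrier_mat n n" by (simp add: D_def)
  have "mat_adjoint U * A * U = (mat_adjoint U * U) * D * (mat_adjoint U * U)"
    unfolding A D_def[symmetric] using U(1) Ua D
    by (simp add: assoc_mult_mat_dim)
  also have "\<dots> = D" using U(2) D by simp
  finally show "mat_adjoint U * A * U = mat_diag n (\<lambda>i. complex_of_real (d i))"
    unfolding D_def .
qed

text \<open>The conjugated matrix is again of the form \<open>T * mat_adjoint T\<close>, with
  \<open>T = mat_adjoint V * M\<close>, so its diagonal consists of squared row norms.\<close>

lemma gram_conjugated_diag_entry:
  assumes M: "M \<in> carrier_mat n m" and V: "V \<in> carrier_mat n n" and i: "i < n"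
  shows "(mat_adjoint V * (M * mat_adjoint M) * V) $$ (i, i) =
    complex_of_real (\<Sum>k<m. (cmod ((mat_adjoint V * M) $$ (i, k)))\<^sup>2)"
proof -
  note Va = mat_adjoint_carrier[OF V]
  note Ma = mat_adjoint_carrier[OF M]
  have T: "mat_adjoint V * M \<in> carrier_mat n m" using Va M by simp
  have "mat_adjoint V * (M * mat_adjoint M) * V = (mat_adjoint V * M) * mat_adjoint (mat_adjoint V * M)"
    using M V by (simp add: mat_adjoint_mult assoc_mult_mat_dim)
  then show ?thesis using mult_adjoint_diag_entry[OF T i] by simp
qed

lemma gram_spectrum_nonneg:
  assumes "unitary_diagonalization (M * mat_adjoint M) U d" "M \<in> carrier_mat n m" "i < n"
  shows "0 \<le> d i"
proof -
  have X: "M * mat_adjoint M \<in> carrier_mat n n" using assms(2) mat_adjoint_carrier by auto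
  note U = unitary_diagonalizationD[OF assms(1) X]
  have "complex_of_real (d i) = complex_of_real (\<Sum>k<m. (cmod ((mat_adjoint U * M) $$ (i, k)))\<^sup>2)"
    using gram_conjugated_diag_entry[OF assms(2) U(1) assms(3)] assms(3) unfolding U(5)
    by (simp add: mat_diag_def)
  then show ?thesis by (simp only: of_real_eq_iff) (simp add: sum_nonneg)
qed

text \<open>The diagonal of \<open>A\<close> in another orthonormal basis is the image of its spectrum under
  the doubly stochastic matrix of squared overlaps.\<close>

lemma renyi_excess_le_diagonal:
  assumes \<alpha>: "0 < \<alpha>" and ud: "unitary_diagonalization A U d" and A: "A \<in> carrier_mat n n"
    and d: "\<And>k. k < n \<Longrightarrow> 0 \<le> d k"
    and V: "V \<in> carrier_mat n n" "mat_adjoint V * V = 1\<^sub>m n"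
  shows "renyi_excess \<alpha> {..<n} d \<le> renyi_excess \<alpha> {..<n} (\<lambda>i. Re ((mat_adjoint V * A * V) $$ (i, i)))"
proof -
  note U = unitary_diagonalizationD[OF ud A]
  note Ua = mat_adjoint_carrier[OF U(1)]
  note Va = mat_adjoint_carrier[OF V(1)]
  define D where "D = mat_diag n (\<lambda>i. complex_of_real (d i))"
  have D: "D \<in> carrier_mat n n" by (simp add: D_def)
  \<comment> \<open>The overlaps of the two bases. Unitarity of \<open>T\<close> gives the row sums,
    and that of its adjoint the column sums, of the squared moduli.\<close>
  define T where "T = mat_adjoint V * U"
  have T: "T \<in> carrier_mat n n" and Ta: "mat_adjoint T = mat_adjoint U * V"
    using U V Va unfolding T_def by (auto simp: mat_adjoint_mult)
  note Tac = mat_adjoint_carrier[OF T]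
  have "T * mat_adjoint T = mat_adjoint V * (U * mat_adjoint U) * V"
    unfolding Ta unfolding T_def using U(1) V(1) Ua Va by (simp add: assoc_mult_mat_dim)
  then have TT: "T * mat_adjoint T = 1\<^sub>m n" using U V Va by simp
  have TT': "mat_adjoint T * T = 1\<^sub>m n" using mat_mult_left_right_inverse[OF T Tac TT] .
  have row: "(\<Sum>k<n. (cmod (T $$ (i, k)))\<^sup>2) = 1" if "i < n" for i
  proof -
    have "complex_of_real (\<Sum>k<n. (cmod (T $$ (i, k)))\<^sup>2) = complex_of_real 1"
      using mult_adjoint_diag_entry[OF T that] that unfolding TT by simp
    then show ?thesis by (simp only: of_real_eq_iff)
  qed
  have col: "(\<Sum>i<n. (cmod (T $$ (i, k)))\<^sup>2) = 1" if "k < n" for k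
  proof -
    have "complex_of_real (\<Sum>i<n. (cmod (mat_adjoint T $$ (k, i)))\<^sup>2) = complex_of_real 1"
      using mult_adjoint_diag_entry[OF Tac that] that TT' by simp
    then have "(\<Sum>i<n. (cmod (mat_adjoint T $$ (k, i)))\<^sup>2) = 1" by (simp only: of_real_eq_iff)
    then show ?thesis using T that by simp
  qed
  have "mat_adjoint V * A * V = T * D * mat_adjoint T"
    unfolding Ta U(4) D_def[symmetric] unfolding T_def using U(1) V(1) Ua Va D by (simp add: assoc_mult_mat_dim)
  moreover have "z * complex_of_real r * cnj z = complex_of_real ((cmod z)\<^sup>2 * r)" for z r
    by (simp only: of_real_mult complex_norm_square mult_ac)
  ultimately have diag: "Re ((mat_adjoint V * A * V) $$ (i, i)) = (\<Sum>k<n. (cmod (T $$ (i, k)))\<^sup>2 * d k)"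
    if "i < n" for i
    using mult_mat_diag_adjoint_index[OF T that that, of "\<lambda>i. complex_of_real (d i)"]
    by (simp only: D_def Re_sum Re_complex_of_real)
  have "renyi_excess \<alpha> {..<n} d \<le> renyi_excess \<alpha> {..<n} (\<lambda>i. \<Sum>k<n. (cmod (T $$ (i, k)))\<^sup>2 * d k)"
    using row col d by (intro renyi_excess_mixing[OF \<alpha>]) auto
  also have "\<dots> = renyi_excess \<alpha> {..<n} (\<lambda>i. Re ((mat_adjoint V * A * V) $$ (i, i)))"
    using diag by (intro renyi_excess_cong) auto
  finally show ?thesis .
qed

text \<open>Each spectrum is the diagonal in its own eigenbasis, so
  \<open>renyi_excess_le_diagonal\<close> bounds either excess by the other. No permutation between
  the two spectra has to be constructed.\<close>

lemma schmidt_excess_eqI: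
  assumes \<alpha>: "0 < \<alpha>" and ud: "unitary_diagonalization (M * mat_adjoint M) U d"
  shows "schmidt_excess \<alpha> M = renyi_excess \<alpha> {..<dim_row M} d"
proof -
  define n where "n = dim_row M"
  define X where "X = M * mat_adjoint M"
  have X: "X \<in> carrier_mat n n" and M: "M \<in> carrier_mat n (dim_col M)" by (auto simp: X_def n_def)
  have le: "renyi_excess \<alpha> {..<n} d' \<le> renyi_excess \<alpha> {..<n} e"
    if d': "unitary_diagonalization X U' d'" and e: "unitary_diagonalization X V e" for U' V d' e
  proof -
    note V = unitary_diagonalizationD[OF e X]
    have "renyi_excess \<alpha> {..<n} d' \<le> renyi_excess \<alpha> {..<n} (\<lambda>i. Re ((mat_adjoint V * X * V) $$ (i, i)))"
      using gram_spectrum_nonneg[OF d'[unfolded X_def] M] V(1,2)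
      by (intro renyi_excess_le_diagonal[OF \<alpha> d' X]) auto
    also have "\<dots> = renyi_excess \<alpha> {..<n} e"
      unfolding V(5) by (intro renyi_excess_cong) (auto simp: mat_diag_def)
    finally show ?thesis .
  qed
  from gram_unitary_diagonalization[of M] obtain V
    where "unitary_diagonalization X V (hermitian_spectrum X)" unfolding X_def by blast
  from le[OF this ud[folded X_def]] le[OF ud[folded X_def] this]
  show ?thesis unfolding schmidt_excess_def X_def n_def by simp
qed

text \<open>The reduced operators of both parties have the same nonzero spectrum. This lets
  measurements on B be treated from the side of A.\<close>

lemma schmidt_excess_adjoint:
  assumes \<alpha>: "0 < \<alpha>"
  shows "schmidt_excess \<alpha> (mat_adjoint M) = schmidt_excess \<alpha> M"
proof -
  define n where "n = dim_row M"
  define m where "m = dim_col M"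
  have M: "M \<in> carrier_mat n m" by (simp add: n_def m_def)
  note Ma = mat_adjoint_carrier[OF M]
  obtain V e where e: "unitary_diagonalization (M * mat_adjoint M) V e"
    using gram_unitary_diagonalization by blast
  obtain U d where d: "unitary_diagonalization (mat_adjoint M * M) U d"
    using gram_unitary_diagonalization[of "mat_adjoint M"] by auto
  have "M * mat_adjoint M \<in> carrier_mat n n" "mat_adjoint M * M \<in> carrier_mat m m"
    using M Ma by auto
  note V = unitary_diagonalizationD[OF e this(1)] and U = unitary_diagonalizationD[OF d this(2)]
  note Ua = mat_adjoint_carrier[OF U(1)] and Va = mat_adjoint_carrier[OF V(1)]
  \<comment> \<open>\<open>M\<close> written in eigenbases of both Gram matrices, which makes
    \<open>T * mat_adjoint T\<close> and \<open>mat_adjoint T * T\<close> diagonal.\<close>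
  define T where "T = mat_adjoint V * M * U"
  have T: "T \<in> carrier_mat n m" using M U(1) Va unfolding T_def by simp
  note Tac = mat_adjoint_carrier[OF T]
  have Ta: "mat_adjoint T = mat_adjoint U * mat_adjoint M * V"
    unfolding T_def using M U(1) V(1) Va Ua Ma by (simp add: mat_adjoint_mult assoc_mult_mat_dim)
  have TT: "T * mat_adjoint T = mat_diag n (\<lambda>i. complex_of_real (e i))"
  proof -
    have "T * mat_adjoint T = mat_adjoint V * (M * (U * mat_adjoint U) * mat_adjoint M) * V"
      unfolding Ta unfolding T_def using M U(1) V(1) Ua Va Ma by (simp add: assoc_mult_mat_dim)
    then show ?thesis using M by (simp only: U(3) right_mult_one_mat[OF M] V(5))
  qed
  have TT': "mat_adjoint T * T = mat_diag m (\<lambda>i. complex_of_real (d i))"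
  proof -
    have "mat_adjoint T * T = mat_adjoint U * (mat_adjoint M * (V * mat_adjoint V) * M) * U"
      unfolding Ta unfolding T_def using M U(1) V(1) Ua Va Ma by (simp add: assoc_mult_mat_dim)
    then show ?thesis by (simp only: V(3) right_mult_one_mat[OF Ma] U(5))
  qed
  have "renyi_excess \<alpha> {..<m} d = renyi_excess \<alpha> {..<n} e"
  proof (rule renyi_excess_coupling[OF \<alpha>, where C = "\<lambda>i k. (cmod (T $$ (i, k)))\<^sup>2"])
    fix i assume "i \<in> {..<n}"
    then have "complex_of_real (\<Sum>k<m. (cmod (T $$ (i, k)))\<^sup>2) = complex_of_real (e i)"
      using mult_adjoint_diag_entry[OF T, of i] by (simp add: TT mat_diag_def)
    then show "(\<Sum>k<m. (cmod (T $$ (i, k)))\<^sup>2) = e i" by (simp only: of_real_eq_iff)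
  next
    fix k assume k: "k \<in> {..<m}"
    then have "complex_of_real (\<Sum>i<n. (cmod (mat_adjoint T $$ (k, i)))\<^sup>2) = complex_of_real (d k)"
      using mult_adjoint_diag_entry[OF Tac, of k] by (simp add: TT' mat_diag_def)
    then have "(\<Sum>i<n. (cmod (mat_adjoint T $$ (k, i)))\<^sup>2) = d k" by (simp only: of_real_eq_iff)
    then show "(\<Sum>i<n. (cmod (T $$ (i, k)))\<^sup>2) = d k" using T k by simp
  next
    fix i k assume ik: "i \<in> {..<n}" "k \<in> {..<m}"
    \<comment> \<open>Associativity makes \<open>T\<close> intertwine the two diagonal matrices, so
      an entry can be nonzero only between equal eigenvalues.\<close>
    have "T * (mat_adjoint T * T) = T * mat_adjoint T * T"
      using T Tac by (simp add: assoc_mult_mat[of T n m _ n T m])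
    then have "T * mat_diag m (\<lambda>i. complex_of_real (d i)) = mat_diag n (\<lambda>i. complex_of_real (e i)) * T"
      by (simp only: TT TT')
    from arg_cong[OF this, of "\<lambda>X. X $$ (i, k)"]
    have "T $$ (i, k) * complex_of_real (d k) = complex_of_real (e i) * T $$ (i, k)"
      using ik by (simp add: mat_diag_mult_left[OF T] mat_diag_mult_right[OF T])
    then show "(cmod (T $$ (i, k)))\<^sup>2 = 0 \<or> e i = d k" by auto
  qed
  then show ?thesis
    using schmidt_excess_eqI[OF \<alpha> e] schmidt_excess_eqI[OF \<alpha>, of "mat_adjoint M" U d] d
    by (simp add: n_def m_def)
qed

section \<open>Sums of matrices and superadditivity of the matrix functional\<close>

lemma foldr_add_mat_carrier:
  fixes Xs :: "complex mat list"
  assumes "\<And>X. X \<in> set Xs \<Longrightarrow> X \<in> carrier_mat k l"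
  shows "foldr (+) Xs (0\<^sub>m k l) \<in> carrier_mat k l"
  using assms by (induction Xs) (simp_all add: add_carrier_mat)

lemma index_foldr_add_mat:
  fixes Xs :: "complex mat list"
  assumes "\<And>X. X \<in> set Xs \<Longrightarrow> X \<in> carrier_mat k l" "i < k" "j < l"
  shows "foldr (+) Xs (0\<^sub>m k l) $$ (i, j) = (\<Sum>X\<leftarrow>Xs. X $$ (i, j))"
  using assms(1)
proof (induction Xs)
  case (Cons X Xs)
  then have "foldr (+) Xs (0\<^sub>m k l) \<in> carrier_mat k l"
    by (intro foldr_add_mat_carrier) simp
  then show ?case using Cons assms(2,3) by simp
qed (use assms in simp)

lemma mult_foldr_add_mat:
  fixes P Q :: "complex mat"
  assumes P: "P \<in> carrier_mat k m" and Q: "Q \<in> carrier_mat n l"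
    and "\<And>X. X \<in> set Xs \<Longrightarrow> X \<in> carrier_mat m n"
  shows "P * foldr (+) Xs (0\<^sub>m m n) * Q = foldr (+) (map (\<lambda>X. P * X * Q) Xs) (0\<^sub>m k l)"
  using assms(3)
proof (induction Xs)
  case (Cons X Xs)
  then have "X \<in> carrier_mat m n" "foldr (+) Xs (0\<^sub>m m n) \<in> carrier_mat m n"
    by (auto intro: foldr_add_mat_carrier)
  then have "P * (X + foldr (+) Xs (0\<^sub>m m n)) * Q = P * X * Q + P * foldr (+) Xs (0\<^sub>m m n) * Q"
    using P Q by (simp add: mult_add_distrib_mat[of _ k m] add_mult_distrib_mat[of _ k n])
  then show ?case using Cons by simp
qed (use P Q in simp)

lemma transpose_foldr_add_mat:
  fixes Xs :: "complex mat list"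
  assumes "\<And>X. X \<in> set Xs \<Longrightarrow> X \<in> carrier_mat m n"
  shows "transpose_mat (foldr (+) Xs (0\<^sub>m m n)) = foldr (+) (map transpose_mat Xs) (0\<^sub>m n m)"
  using assms
proof (induction Xs)
  case (Cons X Xs)
  then have "X \<in> carrier_mat m n" "foldr (+) Xs (0\<^sub>m m n) \<in> carrier_mat m n"
    by (auto intro: foldr_add_mat_carrier)
  then show ?case using Cons by (simp add: transpose_add[of _ m n])
qed simp

lemma Re_sum_list: "Re (\<Sum>x\<leftarrow>xs. f x) = (\<Sum>x\<leftarrow>xs. Re (f x))"
  by (induction xs) simp_all

text \<open>In an eigenbasis of the total Gram matrix, its spectrum is the sum of the diagonals
  \<open>y M\<close> of the summands. Each diagonal has at least the excess of the corresponding
  spectrum, and superadditivity for vectors combines them.\<close>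

lemma schmidt_excess_superadditive:
  assumes \<alpha>: "0 < \<alpha>" and Ms: "\<And>M. M \<in> set Ms \<Longrightarrow> dim_row M = n" and N: "dim_row N = n"
    and sum: "N * mat_adjoint N = foldr (+) (map (\<lambda>M. M * mat_adjoint M) Ms) (0\<^sub>m n n)"
  shows "(\<Sum>M\<leftarrow>Ms. schmidt_excess \<alpha> M) \<le> schmidt_excess \<alpha> N"
proof -
  obtain V d where d: "unitary_diagonalization (N * mat_adjoint N) V d"
    using gram_unitary_diagonalization by blast
  have X: "N * mat_adjoint N \<in> carrier_mat n n" using N by auto
  note V = unitary_diagonalizationD[OF d X]
  note Va = mat_adjoint_carrier[OF V(1)]
  define y where "y M i = Re ((mat_adjoint V * (M * mat_adjoint M) * V) $$ (i, i))" for M i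
  have gram: "M * mat_adjoint M \<in> carrier_mat n n" if "M \<in> set Ms" for M using Ms[OF that] by auto
  have y0: "0 \<le> y M i" if "M \<in> set Ms" "i < n" for M i
  proof -
    have M: "M \<in> carrier_mat n (dim_col M)" using Ms[OF that(1)] by auto
    show ?thesis
      unfolding y_def gram_conjugated_diag_entry[OF M V(1) that(2)] Re_complex_of_real
      by (rule sum_nonneg) simp
  qed
  have di: "d i = (\<Sum>M\<leftarrow>Ms. y M i)" if "i < n" for i
  proof -
    have "d i = Re ((mat_adjoint V * (N * mat_adjoint N) * V) $$ (i, i))"
      using that by (subst V(5)) (simp add: mat_diag_def)
    also have "mat_adjoint V * (N * mat_adjoint N) * V =
        foldr (+) (map (\<lambda>M. mat_adjoint V * (M * mat_adjoint M) * V) Ms) (0\<^sub>m n n)"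
      unfolding sum by (subst mult_foldr_add_mat[OF Va V(1)]) (use gram in \<open>auto simp: comp_def simp del: index_mult_mat\<close>)
    also have "\<dots> $$ (i, i) = (\<Sum>M\<leftarrow>Ms. (mat_adjoint V * (M * mat_adjoint M) * V) $$ (i, i))"
    proof (subst index_foldr_add_mat)
      fix X assume "X \<in> set (map (\<lambda>M. mat_adjoint V * (M * mat_adjoint M) * V) Ms)"
      then show "X \<in> carrier_mat n n" using V(1) by (auto intro: carrier_matI)
    qed (use that in \<open>simp_all add: comp_def\<close>)
    finally show ?thesis unfolding y_def Re_sum_list .
  qed
  have "(\<Sum>M\<leftarrow>Ms. schmidt_excess \<alpha> M) \<le> (\<Sum>M\<leftarrow>Ms. renyi_excess \<alpha> {..<n} (y M))"
  proof (rule sum_list_mono)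
    fix M assume M: "M \<in> set Ms"
    obtain U e where e: "unitary_diagonalization (M * mat_adjoint M) U e"
      using gram_unitary_diagonalization by blast
    have "0 \<le> e k" if "k < n" for k
      using gram_spectrum_nonneg[OF e carrier_matI[OF Ms[OF M] refl] that] .
    then have "renyi_excess \<alpha> {..<n} e \<le> renyi_excess \<alpha> {..<n} (y M)"
      unfolding y_def by (rule renyi_excess_le_diagonal[OF \<alpha> e gram[OF M] _ V(1,2)])
    then show "schmidt_excess \<alpha> M \<le> renyi_excess \<alpha> {..<n} (y M)"
      using schmidt_excess_eqI[OF \<alpha> e] Ms[OF M] by simp
  qed
  also have "\<dots> \<le> renyi_excess \<alpha> {..<n} (\<lambda>i. \<Sum>M\<leftarrow>Ms. y M i)"
    using y0 by (intro renyi_excess_sum_list[OF \<alpha>]) auto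
  also have "\<dots> = renyi_excess \<alpha> {..<n} d"
    using di by (intro renyi_excess_cong) auto
  also have "\<dots> = schmidt_excess \<alpha> N" using schmidt_excess_eqI[OF \<alpha> d] N by simp
  finally show ?thesis .
qed

lemma schmidt_excess_nonneg:
  assumes \<alpha>: "0 < \<alpha>"
  shows "0 \<le> schmidt_excess \<alpha> M"
proof -
  obtain U d where d: "unitary_diagonalization (M * mat_adjoint M) U d"
    using gram_unitary_diagonalization by blast
  have "0 \<le> d i" if "i < dim_row M" for i
    using gram_spectrum_nonneg[OF d carrier_matI[OF refl refl] that] .
  then show ?thesis unfolding schmidt_excess_eqI[OF \<alpha> d] by (intro renyi_excess_nonneg[OF \<alpha>]) auto
qed

lemma unitary_diagonalization_smult:
  assumes "unitary_diagonalization A U d" "A \<in> carrier_mat n n"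
  shows "unitary_diagonalization (complex_of_real c \<cdot>\<^sub>m A) U (\<lambda>i. c * d i)"
proof -
  note U = unitary_diagonalizationD[OF assms]
  note Ua = mat_adjoint_carrier[OF U(1)]
  define D where "D = mat_diag n (\<lambda>i. complex_of_real (d i))"
  have D: "D \<in> carrier_mat n n" by (simp add: D_def)
  have "mat_diag n (\<lambda>i. complex_of_real (c * d i)) = complex_of_real c \<cdot>\<^sub>m D"
    by (intro eq_matI) (auto simp: D_def mat_diag_def)
  moreover have "U * (complex_of_real c \<cdot>\<^sub>m D) * mat_adjoint U = complex_of_real c \<cdot>\<^sub>m (U * D * mat_adjoint U)"
    using U(1) Ua D
    by (simp add: mult_smult_distrib[OF U(1) D] mult_smult_assoc_mat[of "U * D" n n "mat_adjoint U" n])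
  ultimately have "complex_of_real c \<cdot>\<^sub>m A = U * mat_diag n (\<lambda>i. complex_of_real (c * d i)) * mat_adjoint U"
    using U(4) by (simp only: flip: D_def)
  then show ?thesis
    unfolding unitary_diagonalization_def Let_def using U(1-3) assms(2) by simp
qed

text \<open>The Gram matrix is quadratic in \<open>M\<close>, while the excess has degree one. Thus
  an outcome of probability \<open>p\<close> contributes \<open>p\<close> times the value on its
  normalized state.\<close>

lemma schmidt_excess_smult:
  assumes \<alpha>: "0 < \<alpha>"
  shows "schmidt_excess \<alpha> (complex_of_real c \<cdot>\<^sub>m M) = c\<^sup>2 * schmidt_excess \<alpha> M"
proof -
  obtain U d where d: "unitary_diagonalization (M * mat_adjoint M) U d"
    using gram_unitary_diagonalization by blast
  have d0: "0 \<le> d i" if "i < dim_row M" for i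
    using gram_spectrum_nonneg[OF d carrier_matI[OF refl refl] that] .
  have X: "M * mat_adjoint M \<in> carrier_mat (dim_row M) (dim_row M)" by (intro carrier_matI) auto
  have "(complex_of_real c \<cdot>\<^sub>m M) * mat_adjoint (complex_of_real c \<cdot>\<^sub>m M) = complex_of_real (c\<^sup>2) \<cdot>\<^sub>m (M * mat_adjoint M)"
    by (intro eq_matI) (auto simp: scalar_prod_def sum_distrib_left power2_eq_square intro!: sum.cong)
  then have "unitary_diagonalization ((complex_of_real c \<cdot>\<^sub>m M) * mat_adjoint (complex_of_real c \<cdot>\<^sub>m M)) U (\<lambda>i. c\<^sup>2 * d i)"
    using unitary_diagonalization_smult[OF d X, of "c\<^sup>2"] by (simp only:)
  from schmidt_excess_eqI[OF \<alpha> this] have "schmidt_excess \<alpha> (complex_of_real c \<cdot>\<^sub>m M) =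
      renyi_excess \<alpha> {..<dim_row M} (\<lambda>i. c\<^sup>2 * d i)" by simp
  also have "\<dots> = c\<^sup>2 * schmidt_excess \<alpha> M"
    unfolding schmidt_excess_eqI[OF \<alpha> d] using d0 by (intro renyi_excess_scale[OF \<alpha>]) auto
  finally show ?thesis .
qed

subsection \<open>States and protocols\<close>

text \<open>The row index belongs to \<open>B\<close>, so that \<open>A \<otimes> B\<close> acts as \<open>N \<mapsto> B N A\<^sup>T\<close>.\<close>

definition coeff_mat :: "nat \<Rightarrow> nat \<Rightarrow> complex vec \<Rightarrow> complex mat" where
  "coeff_mat a b \<psi> = mat b a (\<lambda>(j, i). \<psi> $ (i * b + j))"

lemma coeff_mat_carrier [simp]: "coeff_mat a b \<psi> \<in> carrier_mat b a"
  by (simp add: coeff_mat_def)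

lemma tensor_index_less: "(i::nat) < a \<Longrightarrow> j < b \<Longrightarrow> i * b + j < a * b"
  using mult_le_mono1[of "Suc i" a b] by simp

lemma sum_tensor_index:
  "(\<Sum>c<a * b. g c) = (\<Sum>i<a. \<Sum>j<b. g (i * b + j))" for g :: "nat \<Rightarrow> 'a::comm_monoid_add"
proof -
  have "(\<Sum>j<b. g (i * b + j)) = sum g {i * b..<i * b + b}" for i
    using sum.shift_bounds_nat_ivl[of g 0 "i * b" b] by (simp add: atLeast0LessThan add.commute)
  then show ?thesis using sum.nat_group[of g b a] by simp
qed

lemma reduced_B_eq_gram:
  assumes "\<psi> \<in> carrier_vec (a * b)"
  shows "reduced_B a b \<psi> = coeff_mat a b \<psi> * mat_adjoint (coeff_mat a b \<psi>)"
  using assms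
  by (intro eq_matI)
    (auto simp: reduced_B_def partial_trace_A_def ketbra_def coeff_mat_def scalar_prod_def
      atLeast0LessThan tensor_index_less intro!: sum.cong)

lemma tensor_op_mult_carrier:
  "tensor_op A B *\<^sub>v \<psi> \<in> carrier_vec (dim_row A * dim_row B)"
  by (simp add: tensor_op_def carrier_vecI)

lemma coeff_mat_tensor_op:
  assumes A: "A \<in> carrier_mat a' a" and B: "B \<in> carrier_mat b' b" and \<psi>: "\<psi> \<in> carrier_vec (a * b)"
  shows "coeff_mat a' b' (tensor_op A B *\<^sub>v \<psi>) = B * coeff_mat a b \<psi> * transpose_mat A"
proof (intro eq_matI)
  fix j i assume "j < dim_row (B * coeff_mat a b \<psi> * transpose_mat A)"
    "i < dim_col (B * coeff_mat a b \<psi> * transpose_mat A)"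
  then have ji: "j < b'" "i < a'" using A B by auto
  have idx: "i * b' + j < a' * b'" using ji by (intro tensor_index_less)
  have "coeff_mat a' b' (tensor_op A B *\<^sub>v \<psi>) $$ (j, i) =
      (\<Sum>c<a * b. A $$ (i, c div b) * B $$ (j, c mod b) * \<psi> $ c)"
    using ji idx A B \<psi> by (simp add: coeff_mat_def tensor_op_def scalar_prod_def atLeast0LessThan)
  also have "\<dots> = (\<Sum>k<a. \<Sum>l<b. A $$ (i, k) * B $$ (j, l) * \<psi> $ (k * b + l))"
    unfolding sum_tensor_index by (intro sum.cong refl) simp
  also have "\<dots> = (B * coeff_mat a b \<psi> * transpose_mat A) $$ (j, i)"
    using ji A B by (simp add: coeff_mat_def scalar_prod_def atLeast0LessThan sum_distrib_left mult_ac)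
  finally show "coeff_mat a' b' (tensor_op A B *\<^sub>v \<psi>) $$ (j, i) =
      (B * coeff_mat a b \<psi> * transpose_mat A) $$ (j, i)" .
qed (use A B in \<open>auto simp: coeff_mat_def\<close>)

section \<open>Traces, norms and the excess of a unit vector\<close>

lemma mat_trace_unitary_diagonal:
  assumes U: "U \<in> carrier_mat n n" "mat_adjoint U * U = 1\<^sub>m n"
  shows "mat_trace (U * mat_diag n f * mat_adjoint U) = (\<Sum>i<n. f i)"
proof -
  have col: "(\<Sum>i<n. U $$ (i, k) * cnj (U $$ (i, k))) = 1" if "k < n" for k
    using arg_cong[OF U(2), of "\<lambda>M. M $$ (k, k)"] U(1) that
    by (simp add: scalar_prod_def atLeast0LessThan mult.commute)
  have "mat_trace (U * mat_diag n f * mat_adjoint U) =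
      (\<Sum>i<n. (U * mat_diag n f * mat_adjoint U) $$ (i, i))"
    using U(1) unfolding mat_trace_def by simp
  also have "\<dots> = (\<Sum>i<n. \<Sum>k<n. U $$ (i, k) * f k * cnj (U $$ (i, k)))"
    by (intro sum.cong refl mult_mat_diag_adjoint_index[OF U(1)]) auto
  also have "\<dots> = (\<Sum>k<n. f k * (\<Sum>i<n. U $$ (i, k) * cnj (U $$ (i, k))))"
    unfolding sum_distrib_left by (subst sum.swap) (simp add: mult_ac)
  finally show ?thesis using col by simp
qed

lemma ket_norm_eq:
  assumes "\<psi> \<in> carrier_vec n"
  shows "ket_norm \<psi> = sqrt (\<Sum>k<n. (cmod (\<psi> $ k))\<^sup>2)"
  using assms
  by (simp add: ket_norm_def scalar_prod_def atLeast0LessThan cmod_power2 flip: power2_eq_square)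

lemma ket_norm_squared:
  assumes "\<psi> \<in> carrier_vec n"
  shows "(ket_norm \<psi>)\<^sup>2 = (\<Sum>k<n. (cmod (\<psi> $ k))\<^sup>2)"
  unfolding ket_norm_eq[OF assms] by (simp add: sum_nonneg)

text \<open>The value of the functional on a unit vector of entanglement entropy \<open>E\<close>.\<close>

definition renyi_threshold :: "real \<Rightarrow> real \<Rightarrow> real" where
  "renyi_threshold \<alpha> E = (if \<alpha> = 1 then E else sgn (1 - \<alpha>) * (exp ((1 - \<alpha>) / \<alpha> * E) - 1))"

text \<open>For \<open>\<alpha> > 1\<close> the factor in the exponent and the sign in front are
  both negative, and the two reversals cancel.\<close>

lemma renyi_threshold_mono:
  assumes "0 < \<alpha>" "E \<le> E'"
  shows "renyi_threshold \<alpha> E \<le> renyi_threshold \<alpha> E'"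
proof -
  consider "\<alpha> = 1" | "\<alpha> < 1" | "1 < \<alpha>" by linarith
  then show ?thesis
  proof cases
    case 2
    then have "(1 - \<alpha>) / \<alpha> * E \<le> (1 - \<alpha>) / \<alpha> * E'" using assms by (intro mult_left_mono) auto
    then show ?thesis using 2 by (simp add: renyi_threshold_def)
  next
    case 3
    then have "(1 - \<alpha>) / \<alpha> * E' \<le> (1 - \<alpha>) / \<alpha> * E"
      using assms by (intro mult_left_mono_neg) (auto simp: divide_nonpos_pos)
    then show ?thesis using 3 by (simp add: renyi_threshold_def)
  qed (use assms in \<open>simp add: renyi_threshold_def\<close>)
qed

lemma renyi_threshold_pos:
  assumes "0 < \<alpha>" "0 < E"
  shows "0 < renyi_threshold \<alpha> E"
proof -
  consider "\<alpha> = 1" | "\<alpha> < 1" | "1 < \<alpha>" by linarith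
  then show ?thesis
  proof cases
    case 3
    then have "(1 - \<alpha>) / \<alpha> * E < 0" using assms by (intro mult_neg_pos divide_neg_pos) auto
    then show ?thesis using 3 by (simp add: renyi_threshold_def)
  qed (use assms in \<open>simp_all add: renyi_threshold_def\<close>)
qed

text \<open>The eigenvalues of the reduced state sum to 1. For \<open>\<alpha> = 1\<close> the
  logarithm of the total vanishes; otherwise the exponential of
  \<open>(1 - \<alpha>) / \<alpha>\<close> times the entropy is the power sum raised to
  \<open>1 / \<alpha>\<close>.\<close>

lemma schmidt_excess_state:
  assumes \<alpha>: "0 < \<alpha>" and \<psi>: "\<psi> \<in> carrier_vec (a * b)" and norm: "ket_norm \<psi> = 1"
  shows "schmidt_excess \<alpha> (coeff_mat a b \<psi>) = renyi_threshold \<alpha> (REE \<alpha> a b \<psi>)"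
proof -
  define N where "N = coeff_mat a b \<psi>"
  have N: "N \<in> carrier_mat b a" by (simp add: N_def)
  then have X: "N * mat_adjoint N \<in> carrier_mat b b" by auto
  obtain U d where d: "unitary_diagonalization (N * mat_adjoint N) U d"
    using gram_unitary_diagonalization by blast
  note U = unitary_diagonalizationD[OF d X]
  have d0: "0 \<le> d i" if "i < b" for i using gram_spectrum_nonneg[OF d N that] .
  have \<rho>: "reduced_B a b \<psi> = N * mat_adjoint N" using reduced_B_eq_gram[OF \<psi>] by (simp add: N_def)
  have f: "mat_fun f (N * mat_adjoint N) = U * mat_diag b (\<lambda>i. complex_of_real (f (d i))) * mat_adjoint U" for f
    using mat_fun_eqI[OF d, of f] N by simp
  have "complex_of_real (\<Sum>i<b. d i) = mat_trace (N * mat_adjoint N)"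
    by (subst U(4)) (simp add: mat_trace_unitary_diagonal[OF U(1,2)])
  also have "\<dots> = (\<Sum>j<b. complex_of_real (\<Sum>i<a. (cmod (N $$ (j, i)))\<^sup>2))"
    unfolding mat_trace_def using N
    by (intro sum.cong mult_adjoint_diag_entry[OF N]) auto
  also have "\<dots> = complex_of_real (\<Sum>j<b. \<Sum>i<a. (cmod (\<psi> $ (i * b + j)))\<^sup>2)"
    by (simp add: N_def coeff_mat_def)
  also have "(\<Sum>j<b. \<Sum>i<a. (cmod (\<psi> $ (i * b + j)))\<^sup>2) = (ket_norm \<psi>)\<^sup>2"
    unfolding ket_norm_squared[OF \<psi>] sum_tensor_index by (rule sum.swap)
  finally have d1: "(\<Sum>i<b. d i) = 1" unfolding norm by (simp only: of_real_eq_iff) simp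
  have "schmidt_excess \<alpha> N = renyi_excess \<alpha> {..<b} d"
    using schmidt_excess_eqI[OF \<alpha> d] N by simp
  also have "\<dots> = renyi_threshold \<alpha> (REE \<alpha> a b \<psi>)"
  proof (cases "\<alpha> = 1")
    case True
    have "N * mat_adjoint N * mat_fun ln (N * mat_adjoint N) =
        U * mat_diag b (\<lambda>i. complex_of_real (d i)) * (mat_adjoint U * U) *
          mat_diag b (\<lambda>i. complex_of_real (ln (d i))) * mat_adjoint U"
      unfolding f by (subst U(4)) (use carrier_matD[OF U(1)] in \<open>simp add: assoc_mult_mat_dim\<close>)
    also have "\<dots> = U * (mat_diag b (\<lambda>i. complex_of_real (d i)) *
        mat_diag b (\<lambda>i. complex_of_real (ln (d i)))) * mat_adjoint U"
      using U(1) by (simp add: U(2) assoc_mult_mat_dim)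
    finally have "mat_trace (N * mat_adjoint N * mat_fun ln (N * mat_adjoint N)) =
        complex_of_real (\<Sum>i<b. d i * ln (d i))"
      by (simp add: mat_trace_unitary_diagonal[OF U(1,2)])
    then have "REE \<alpha> a b \<psi> = - (\<Sum>i<b. d i * ln (d i))"
      unfolding REE_def vN_entropy_B_def Let_def \<rho> using True by simp
    then show ?thesis using True by (simp add: renyi_excess_def renyi_threshold_def d1 sum_negf)
  next
    case False
    define s where "s = (\<Sum>i<b. d i powr \<alpha>)"
    \<comment> \<open>Total 1 rules out a zero spectrum, so \<open>s\<close> is positive and the
      exponential inverts its logarithm.\<close>
    have "\<exists>i<b. d i \<noteq> 0" using d1 by (metis lessThan_iff sum.neutral zero_neq_one)
    then have "s \<noteq> 0" unfolding s_def by (subst sum_nonneg_eq_0_iff) auto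
    moreover have "0 \<le> s" unfolding s_def by (intro sum_nonneg) auto
    ultimately have s: "0 < s" by simp
    have "Re (mat_trace (mat_fun (\<lambda>x. x powr \<alpha>) (N * mat_adjoint N))) = s"
      unfolding f mat_trace_unitary_diagonal[OF U(1,2)] by (simp add: s_def)
    then have "REE \<alpha> a b \<psi> = 1 / (1 - \<alpha>) * ln s"
      unfolding REE_def \<rho> using False by simp
    then have "exp ((1 - \<alpha>) / \<alpha> * REE \<alpha> a b \<psi>) = s powr (1 / \<alpha>)"
      using s False \<alpha> by (simp add: powr_def)
    then show ?thesis using False by (simp add: renyi_excess_def renyi_threshold_def d1 s_def)
  qed
  finally show ?thesis unfolding N_def .
qed

text \<open>An operator on A multiplies \<open>N\<close> from the right by its transpose, so the
  transposed completeness relation, placed between \<open>N\<close> and its adjoint, splits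
  \<open>N * mat_adjoint N\<close>.\<close>

lemma schmidt_excess_measure_A:
  assumes \<alpha>: "0 < \<alpha>" and N: "N \<in> carrier_mat b a" and meas: "local_measurement a Ks"
  shows "(\<Sum>K\<leftarrow>Ks. schmidt_excess \<alpha> (N * transpose_mat K)) \<le> schmidt_excess \<alpha> N"
proof -
  have K: "dim_col K = a" if "K \<in> set Ks" for K using meas that by (simp add: local_measurement_def)
  define Xs where "Xs = map (\<lambda>K. mat_adjoint K * K) Ks"
  have Xs: "X \<in> carrier_mat a a" if "X \<in> set Xs" for X using K that by (auto simp: Xs_def)
  have gram: "N * transpose_mat K * mat_adjoint (N * transpose_mat K) =
      N * transpose_mat (mat_adjoint K * K) * mat_adjoint N" if "K \<in> set Ks" for K
  proof -
    have "transpose_mat (mat_adjoint K * K) = transpose_mat K * mat_adjoint (transpose_mat K)"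
      by (intro eq_matI) (auto simp: scalar_prod_def mult.commute)
    then show ?thesis using N K[OF that] by (simp add: mat_adjoint_mult assoc_mult_mat_dim)
  qed
  have "1\<^sub>m a = transpose_mat (foldr (+) Xs (0\<^sub>m a a))"
    using meas by (simp add: local_measurement_def Xs_def)
  also have "\<dots> = foldr (+) (map transpose_mat Xs) (0\<^sub>m a a)"
    using Xs by (rule transpose_foldr_add_mat)
  finally have one: "1\<^sub>m a = foldr (+) (map transpose_mat Xs) (0\<^sub>m a a)" .
  have "N * mat_adjoint N = N * foldr (+) (map transpose_mat Xs) (0\<^sub>m a a) * mat_adjoint N"
    using N by (simp flip: one)
  also have "\<dots> = foldr (+) (map (\<lambda>X. N * X * mat_adjoint N) (map transpose_mat Xs)) (0\<^sub>m b b)"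
    using Xs by (intro mult_foldr_add_mat[OF N mat_adjoint_carrier[OF N]]) auto
  also have "map (\<lambda>X. N * X * mat_adjoint N) (map transpose_mat Xs) =
      map (\<lambda>M. M * mat_adjoint M) (map (\<lambda>K. N * transpose_mat K) Ks)"
    unfolding Xs_def map_map comp_def using gram by (intro map_cong refl) simp
  finally have "(\<Sum>M\<leftarrow>map (\<lambda>K. N * transpose_mat K) Ks. schmidt_excess \<alpha> M) \<le> schmidt_excess \<alpha> N"
    using N by (intro schmidt_excess_superadditive[OF \<alpha>, of _ b]) auto
  then show ?thesis by (simp add: comp_def)
qed

text \<open>An operator on B multiplies from the left, so completeness splits
  \<open>mat_adjoint N * N\<close> instead. Superadditivity is applied to the adjoints and carried
  back by \<open>schmidt_excess_adjoint\<close>.\<close>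

lemma schmidt_excess_measure_B:
  assumes \<alpha>: "0 < \<alpha>" and N: "N \<in> carrier_mat b a" and meas: "local_measurement b Ks"
  shows "(\<Sum>K\<leftarrow>Ks. schmidt_excess \<alpha> (K * N)) \<le> schmidt_excess \<alpha> N"
proof -
  note Na = mat_adjoint_carrier[OF N]
  have K: "dim_col K = b" if "K \<in> set Ks" for K using meas that by (simp add: local_measurement_def)
  define Xs where "Xs = map (\<lambda>K. mat_adjoint K * K) Ks"
  have Xs: "X \<in> carrier_mat b b" if "X \<in> set Xs" for X using K that by (auto simp: Xs_def)
  have one: "foldr (+) Xs (0\<^sub>m b b) = 1\<^sub>m b"
    using meas by (simp add: local_measurement_def Xs_def)
  have "mat_adjoint N * mat_adjoint (mat_adjoint N) = mat_adjoint N * foldr (+) Xs (0\<^sub>m b b) * N"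
    using N unfolding one by simp
  also have "\<dots> = foldr (+) (map (\<lambda>X. mat_adjoint N * X * N) Xs) (0\<^sub>m a a)"
    using Xs by (intro mult_foldr_add_mat[OF Na N]) auto
  also have "map (\<lambda>X. mat_adjoint N * X * N) Xs =
      map (\<lambda>M. M * mat_adjoint M) (map (\<lambda>K. mat_adjoint (K * N)) Ks)"
    unfolding Xs_def map_map comp_def using N K
    by (intro map_cong refl) (simp add: mat_adjoint_mult assoc_mult_mat_dim)
  finally have "(\<Sum>M\<leftarrow>map (\<lambda>K. mat_adjoint (K * N)) Ks. schmidt_excess \<alpha> M) \<le> schmidt_excess \<alpha> (mat_adjoint N)"
    using N by (intro schmidt_excess_superadditive[OF \<alpha>, of _ a]) auto
  then show ?thesis by (simp add: comp_def schmidt_excess_adjoint[OF \<alpha>])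
qed

section \<open>Monotonicity along protocols and the bound\<close>

lemma outcome_ops_carrier:
  assumes "slocc_protocol a b P" "(A, B) \<in> set (outcome_ops a b P)"
  shows "dim_col A = a \<and> dim_col B = b"
  using assms
proof (induction P arbitrary: a b A B)
  case (Measure_A bs)
  then show ?case by (fastforce simp: local_measurement_def)
next
  case (Measure_B bs)
  then show ?case by (fastforce simp: local_measurement_def)
qed simp

lemma sum_list_concat_map:
  fixes f :: "'b \<Rightarrow> 'c::comm_monoid_add"
  shows "(\<Sum>y\<leftarrow>concat (map g xs). f y) = (\<Sum>x\<leftarrow>xs. \<Sum>y\<leftarrow>g x. f y)"
  by (induction xs) simp_all

text \<open>Induction on the decision tree: the hypothesis bounds the leaves below each branch by
  the branch, and the measurement lemmas bound the branches by the root. With unnormalized matrices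
  the probabilities are implicit, and outcomes of probability 0 need no separate treatment.\<close>

lemma schmidt_excess_protocol:
  assumes \<alpha>: "0 < \<alpha>" and "slocc_protocol a b P" "N \<in> carrier_mat b a"
  shows "(\<Sum>(A, B)\<leftarrow>outcome_ops a b P. schmidt_excess \<alpha> (B * N * transpose_mat A)) \<le> schmidt_excess \<alpha> N"
  using assms(2,3)
proof (induction P arbitrary: a b N)
  case Stop
  then show ?case by simp
next
  case (Measure_A bs)
  let ?G = "schmidt_excess \<alpha>"
  have meas: "local_measurement a (map fst bs)" using Measure_A.prems by simp
  have "(\<Sum>(A, B)\<leftarrow>outcome_ops a b (Measure_A bs). ?G (B * N * transpose_mat A)) =
      (\<Sum>(K, Q)\<leftarrow>bs. \<Sum>(A, B)\<leftarrow>outcome_ops (dim_row K) b Q. ?G (B * N * transpose_mat (A * K)))"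
    by (simp add: sum_list_concat_map comp_def case_prod_unfold)
  also have "\<dots> \<le> (\<Sum>(K, Q)\<leftarrow>bs. ?G (N * transpose_mat K))"
  proof (rule sum_list_mono, clarify)
    fix K Q assume KQ: "(K, Q) \<in> set bs"
    then have Q: "slocc_protocol (dim_row K) b Q" and K: "dim_col K = a"
      using Measure_A.prems by (auto simp: local_measurement_def)
    have "(\<Sum>(A, B)\<leftarrow>outcome_ops (dim_row K) b Q. ?G (B * N * transpose_mat (A * K))) =
        (\<Sum>(A, B)\<leftarrow>outcome_ops (dim_row K) b Q. ?G (B * (N * transpose_mat K) * transpose_mat A))"
    proof (intro arg_cong[where f = sum_list] map_cong refl, clarify)
      fix A B assume "(A, B) \<in> set (outcome_ops (dim_row K) b Q)"
      then have "dim_col A = dim_row K" "dim_col B = b" using outcome_ops_carrier[OF Q] by auto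
      then show "?G (B * N * transpose_mat (A * K)) = ?G (B * (N * transpose_mat K) * transpose_mat A)"
        using K Measure_A.prems(2)
          transpose_mult[OF carrier_matI[OF refl \<open>dim_col A = dim_row K\<close>] carrier_matI[OF refl K]]
        by (simp add: assoc_mult_mat_dim)
    qed
    also have "\<dots> \<le> ?G (N * transpose_mat K)"
      using Measure_A.prems(2) K by (intro Measure_A.IH[OF KQ _ Q]) (auto intro: carrier_matI)
    finally show "(\<Sum>(A, B)\<leftarrow>outcome_ops (dim_row K) b Q. ?G (B * N * transpose_mat (A * K)))
      \<le> ?G (N * transpose_mat K)" .
  qed
  also have "\<dots> = (\<Sum>K\<leftarrow>map fst bs. ?G (N * transpose_mat K))"
    by (simp add: comp_def case_prod_unfold)
  also have "\<dots> \<le> ?G N" using schmidt_excess_measure_A[OF \<alpha> Measure_A.prems(2) meas] .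
  finally show ?case .
next
  case (Measure_B bs)
  let ?G = "schmidt_excess \<alpha>"
  have meas: "local_measurement b (map fst bs)" using Measure_B.prems by simp
  have "(\<Sum>(A, B)\<leftarrow>outcome_ops a b (Measure_B bs). ?G (B * N * transpose_mat A)) =
      (\<Sum>(K, Q)\<leftarrow>bs. \<Sum>(A, B)\<leftarrow>outcome_ops a (dim_row K) Q. ?G (B * K * N * transpose_mat A))"
    by (simp add: sum_list_concat_map comp_def case_prod_unfold)
  also have "\<dots> \<le> (\<Sum>(K, Q)\<leftarrow>bs. ?G (K * N))"
  proof (rule sum_list_mono, clarify)
    fix K Q assume KQ: "(K, Q) \<in> set bs"
    then have Q: "slocc_protocol a (dim_row K) Q" and K: "dim_col K = b"
      using Measure_B.prems by (auto simp: local_measurement_def)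
    have "(\<Sum>(A, B)\<leftarrow>outcome_ops a (dim_row K) Q. ?G (B * K * N * transpose_mat A)) =
        (\<Sum>(A, B)\<leftarrow>outcome_ops a (dim_row K) Q. ?G (B * (K * N) * transpose_mat A))"
    proof (intro arg_cong[where f = sum_list] map_cong refl, clarify)
      fix A B assume "(A, B) \<in> set (outcome_ops a (dim_row K) Q)"
      then have "dim_col B = dim_row K" using outcome_ops_carrier[OF Q] by auto
      then show "?G (B * K * N * transpose_mat A) = ?G (B * (K * N) * transpose_mat A)"
        using K Measure_B.prems(2) by (simp add: assoc_mult_mat_dim[of B K N])
    qed
    also have "\<dots> \<le> ?G (K * N)"
      using Measure_B.prems(2) K by (intro Measure_B.IH[OF KQ _ Q]) (auto intro: carrier_matI)
    finally show "(\<Sum>(A, B)\<leftarrow>outcome_ops a (dim_row K) Q. ?G (B * K * N * transpose_mat A))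
      \<le> ?G (K * N)" .
  qed
  also have "\<dots> = (\<Sum>K\<leftarrow>map fst bs. ?G (K * N))"
    by (simp add: comp_def case_prod_unfold)
  also have "\<dots> \<le> ?G N" using schmidt_excess_measure_B[OF \<alpha> Measure_B.prems(2) meas] .
  finally show ?case .
qed

text \<open>The coefficient matrix of the unnormalized outcome is \<open>sqrt p\<close> times that
  of the outcome state, so its excess is \<open>p\<close> times the threshold function at the
  entropy of that state, which is monotone.\<close>

lemma outcome_excess_ge:
  assumes \<alpha>: "0 < \<alpha>" and \<psi>: "\<psi> \<in> carrier_vec (a * b)" and AB: "dim_col A = a" "dim_col B = b"
    and p: "0 < outcome_prob \<psi> (A, B)" and E: "E \<le> outcome_REE \<alpha> \<psi> (A, B)"
  shows "outcome_prob \<psi> (A, B) * renyi_threshold \<alpha> E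
    \<le> schmidt_excess \<alpha> (B * coeff_mat a b \<psi> * transpose_mat A)"
proof -
  define a' b' where "a' = dim_row A" and "b' = dim_row B"
  have A: "A \<in> carrier_mat a' a" and B: "B \<in> carrier_mat b' b" using AB by (auto simp: a'_def b'_def)
  define p where "p = outcome_prob \<psi> (A, B)"
  define \<phi> where "\<phi> = tensor_op A B *\<^sub>v \<psi>"
  define \<chi> where "\<chi> = outcome_state \<psi> (A, B)"
  have p0: "0 < p" and p\<phi>: "p = (ket_norm \<phi>)\<^sup>2"
    using \<open>0 < outcome_prob \<psi> (A, B)\<close> by (auto simp: p_def \<phi>_def outcome_prob_def)
  have \<phi>: "\<phi> \<in> carrier_vec (a' * b')" unfolding \<phi>_def a'_def b'_def by (rule tensor_op_mult_carrier)
  have \<chi>_eq: "\<chi> = complex_of_real (1 / sqrt p) \<cdot>\<^sub>v \<phi>" by (simp add: \<chi>_def \<phi>_def p_def outcome_state_def)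
  then have \<chi>: "\<chi> \<in> carrier_vec (a' * b')" using \<phi> by simp
  have "(\<Sum>k<a' * b'. (cmod (\<chi> $ k))\<^sup>2) = (\<Sum>k<a' * b'. (1 / p) * (cmod (\<phi> $ k))\<^sup>2)"
    using \<phi> p0
    by (intro sum.cong refl) (auto simp: \<chi>_eq norm_mult norm_divide power_divide power_mult_distrib)
  also have "\<dots> = 1" using p0 unfolding sum_distrib_left[symmetric] ket_norm_squared[OF \<phi>, symmetric] p\<phi>[symmetric] by simp
  finally have "ket_norm \<chi> = 1"
    by (simp add: ket_norm_eq[OF \<chi>])
  then have "schmidt_excess \<alpha> (coeff_mat a' b' \<chi>) = renyi_threshold \<alpha> (outcome_REE \<alpha> \<psi> (A, B))"
    using schmidt_excess_state[OF \<alpha> \<chi>] by (simp add: outcome_REE_def a'_def b'_def \<chi>_def)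
  then have "p * renyi_threshold \<alpha> E \<le> p * schmidt_excess \<alpha> (coeff_mat a' b' \<chi>)"
    using renyi_threshold_mono[OF \<alpha> E] p0 by simp
  also have "coeff_mat a' b' \<chi> = complex_of_real (1 / sqrt p) \<cdot>\<^sub>m coeff_mat a' b' \<phi>"
    unfolding \<chi>_eq using \<phi> by (intro eq_matI) (auto simp: coeff_mat_def tensor_index_less)
  also have "p * schmidt_excess \<alpha> \<dots> = schmidt_excess \<alpha> (coeff_mat a' b' \<phi>)"
    unfolding schmidt_excess_smult[OF \<alpha>] using p0 by (simp add: power_divide)
  also have "coeff_mat a' b' \<phi> = B * coeff_mat a b \<psi> * transpose_mat A"
    unfolding \<phi>_def by (rule coeff_mat_tensor_op[OF A B \<psi>])
  finally show ?thesis unfolding p_def .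
qed

theorem proposition2:
  fixes \<alpha> E_target :: real and dA dB :: nat and \<Psi> :: "complex vec" and \<P> :: protocol
  assumes "\<alpha> > 0" and "E_target > 0"
    and "\<Psi> \<in> carrier_vec (dA * dB)" and "ket_norm \<Psi> = 1"
    and "slocc_protocol dA dB \<P>"
  shows "success_prob \<alpha> E_target dA dB \<Psi> \<P> \<le>
    (if \<alpha> = 1 then REE 1 dA dB \<Psi> / E_target
     else (exp ((1 - \<alpha>) / \<alpha> * REE \<alpha> dA dB \<Psi>) - 1) / (exp ((1 - \<alpha>) / \<alpha> * E_target) - 1))"
proof -
  note \<alpha> = assms(1)
  define ops where "ops = outcome_ops dA dB \<P>"
  define S where "S = {m. m < length ops \<and> outcome_prob \<Psi> (ops ! m) > 0 \<and>
    outcome_REE \<alpha> \<Psi> (ops ! m) \<ge> E_target}"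
  define N where "N = coeff_mat dA dB \<Psi>"
  define G where "G = (\<lambda>(A, B). schmidt_excess \<alpha> (B * N * transpose_mat A))"
  \<comment> \<open>Markov's inequality, multiplied out: each successful outcome contributes at
    least its probability times the threshold.\<close>
  have "success_prob \<alpha> E_target dA dB \<Psi> \<P> * renyi_threshold \<alpha> E_target =
      (\<Sum>m\<in>S. outcome_prob \<Psi> (ops ! m) * renyi_threshold \<alpha> E_target)"
    by (simp add: success_prob_def Let_def ops_def S_def sum_distrib_right)
  also have "\<dots> \<le> (\<Sum>m\<in>S. G (ops ! m))"
  proof (rule sum_mono)
    fix m assume m: "m \<in> S"
    obtain A B where AB: "ops ! m = (A, B)" by fastforce
    have "(A, B) \<in> set ops" using m AB nth_mem[of m ops] by (simp add: S_def)
    then have "dim_col A = dA" "dim_col B = dB"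
      using outcome_ops_carrier[OF assms(5)] by (auto simp: ops_def)
    then show "outcome_prob \<Psi> (ops ! m) * renyi_threshold \<alpha> E_target \<le> G (ops ! m)"
      using outcome_excess_ge[OF \<alpha> assms(3)] m by (simp add: AB S_def G_def N_def)
  qed
  also have "\<dots> \<le> (\<Sum>m<length ops. G (ops ! m))"
    \<comment> \<open>The outcomes added here, failures and those of probability 0, have nonnegative
      excess.\<close>
    by (rule sum_mono2) (auto simp: S_def G_def schmidt_excess_nonneg[OF \<alpha>] split: prod.splits)
  also have "\<dots> = (\<Sum>AB\<leftarrow>ops. G AB)" by (simp add: sum_list_sum_nth atLeast0LessThan)
  also have "\<dots> \<le> schmidt_excess \<alpha> N"
    unfolding ops_def G_def by (rule schmidt_excess_protocol[OF \<alpha> assms(5)]) (simp add: N_def)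
  also have "\<dots> = renyi_threshold \<alpha> (REE \<alpha> dA dB \<Psi>)"
    unfolding N_def by (rule schmidt_excess_state[OF \<alpha> assms(3,4)])
  finally have "success_prob \<alpha> E_target dA dB \<Psi> \<P> \<le>
      renyi_threshold \<alpha> (REE \<alpha> dA dB \<Psi>) / renyi_threshold \<alpha> E_target"
    using renyi_threshold_pos[OF \<alpha> assms(2)] by (simp add: pos_le_divide_eq)
  \<comment> \<open>For \<open>\<alpha> > 1\<close> the sign is -1 in numerator and denominator
    alike and cancels.\<close>
  moreover have "(1 - x) / (1 - y) = (x - 1) / (y - 1)" for x y :: real
    by (metis minus_diff_eq minus_divide_left minus_divide_right minus_minus)
  ultimately show ?thesis by (cases "\<alpha> < 1") (auto simp: renyi_threshold_def split: if_splits)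
qed

end
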